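(* Let $N\ge1$ and $K,S\in T(M)$. For a vector field $X\in T(M)$ let $\hat X_N\in T(\hat M_N)$ denote its perturbation vector field $$\hat X_N(\hat\eta_N)=\bigl(X^{(0)T},X^{(1)T},\dots,X^{(N)T}\bigr)^T,\qquad X^{(i)}=\frac1{i!}\left.\frac{\partial^iX(\hat u_N)}{\partial\varepsilon^i}\right|_{\varepsilon=0},\qquad \hat u_N=\sum_{i=0}^N\varepsilon^i\eta_i .$$ Then there is the following relation between the perturbation vector fields $\hat K_N$ and $\hat S_N$: $$[\hat K_N(\hat\eta_N),\hat S_N(\hat\eta_N)]=(\hat K_N)'(\hat\eta_N)[\hat S_N(\hat\eta_N)]-(\hat S_N)'(\hat\eta_N)[\hat K_N(\hat\eta_N)]=\hat T_N(\hat\eta_N),$$ where $\hat T_N$ is the perturbation vector field of the vector field $T=[K,S]\in T(M)$. Therefore: (1) if $\sigma\in T(M)$ is an $n$-th order master symmetry of the equation $u_t=K(u)$, then $\hat\sigma_N=(\sigma^{(0)T},\sigma^{(1)T},\dots,\sigma^{(N)T})^T\in T(\hat M_N)$ is an $n$-th order master symmetry of the perturbation equation $\hat\eta_{Nt}=\hat K_N(\hat\eta_N)$; (2) the perturbation equation $\hat\eta_{Nt}=\hat K_N(\hat\eta_N)$ possesses the same symmetry algebra structure as the original equation $u_t=K(u)$.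
   Context: Setting. $M=M(u)$ is a suitable manifold with variable $u$, a column vector (typically of functions); $\hat M_N=\hat M_N(\hat\eta_N)$ is another suitable manifold with variable $\hat\eta_N=(\eta_0^T,\eta_1^T,\dots,\eta_N^T)^T$, where each $\eta_i$ is a column vector of the same dimension as $u$. $T(M)$ and $T(\hat M_N)$ denote the tangent bundles; $K\in T(M)$ means that $K$ is a vector field on $M$. Gateaux derivative: $X'(u)[S(u)]=\left.\frac{\partial}{\partial\varepsilon}X(u+\varepsilon S(u))\right|_{\varepsilon=0}$. Commutator and adjoint map: $[K,S](u)=K'(u)[S(u)]-S'(u)[K(u)]$, $\mathrm{ad}_KS=[K,S]$; likewise on $\hat M_N$. The perturbation equation $\hat\eta_{Nt}=\hat K_N(\hat\eta_N)$ is, in components, $\eta_{it}=\frac1{i!}\left.\frac{\partial^iK(\hat u_N)}{\partial\varepsilon^i}\right|_{\varepsilon=0}$, $0\le i\le N$; it is equivalent to requiring $\hat u_{Nt}=K(\hat u_N)+o(\varepsilon^N)$. A vector field $\sigma\in T(M)$ is called an $n$-th order master symmetry of $u_t=K(u)$ if $(\mathrm{ad}_K)^{n+1}\sigma=0$ (standard definition); the same definition applies to $\hat\eta_{Nt}=\hat K_N(\hat\eta_N)$ on $\hat M_N$. The symmetry algebra of an evolution equation is the algebra of its symmetries under the commutator $[\cdot,\cdot]$. *)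

theory Defs
  imports "HOL-Analysis.Analysis"
begin

text \<open>
  Model spaces are Hausdorff locally convex real topological vector spaces. They cover spaces of
  (column vectors of) smooth or rapidly decreasing functions, on which nonlinear differential
  operators are smooth vector fields although they are in general not so on a normed space.
\<close>

class hausdorff_lcs = real_vector + topological_ab_group_add + t2_space +
  assumes tendsto_scaleR_Pair: "LIM x (nhds (a::real) \<times>\<^sub>F nhds b). fst x *\<^sub>R snd x :> nhds (a *\<^sub>R b)"
    and convex_nhds_0_raw: "open U \<Longrightarrow> 0 \<in> U \<Longrightarrow> \<exists>V. open V \<and> 0 \<in> V \<and>
      (\<forall>x\<in>V. \<forall>y\<in>V. \<forall>s\<ge>0. \<forall>t\<ge>0. s + t = 1 \<longrightarrow> s *\<^sub>R x + t *\<^sub>R y \<in> V) \<and> V \<subseteq> U"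

lemma convex_nhds_0:
  fixes U :: "'a::hausdorff_lcs set"
  shows "open U \<Longrightarrow> 0 \<in> U \<Longrightarrow> \<exists>V. open V \<and> 0 \<in> V \<and> convex V \<and> V \<subseteq> U"
  unfolding convex_def by (rule convex_nhds_0_raw)

instance real_normed_vector \<subseteq> hausdorff_lcs
proof
  fix a :: real and b :: 'a
  show "LIM x (nhds a \<times>\<^sub>F nhds b). fst x *\<^sub>R snd x :> nhds (a *\<^sub>R b)"
    by (intro tendsto_scaleR filterlim_fst filterlim_snd)
next
  fix U :: "'a set"
  assume "open U" "0 \<in> U"
  then obtain e where "e > 0" "ball 0 e \<subseteq> U"
    by (meson open_contains_ball)
  then show "\<exists>V. open V \<and> 0 \<in> V \<and>
      (\<forall>x\<in>V. \<forall>y\<in>V. \<forall>s\<ge>0. \<forall>t\<ge>0. s + t = 1 \<longrightarrow> s *\<^sub>R x + t *\<^sub>R y \<in> V) \<and> V \<subseteq> U"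
    unfolding convex_def[symmetric]
    by (intro exI[of _ "ball 0 e"]) auto
qed

instance vec :: (topological_monoid_add, finite) topological_monoid_add
proof
  fix a b :: "('a, 'b) vec"
  show "LIM x (nhds a \<times>\<^sub>F nhds b). fst x + snd x :> nhds (a + b)"
    by (intro vec_tendstoI, unfold vector_add_component,
        intro tendsto_add tendsto_vec_nth filterlim_fst filterlim_snd)
qed

instance vec :: (topological_group_add, finite) topological_group_add
proof
  fix a :: "('a, 'b) vec"
  show "(uminus \<longlongrightarrow> - a) (nhds a)"
    by (intro vec_tendstoI, unfold vector_uminus_component,
        intro tendsto_minus tendsto_vec_nth filterlim_ident)
qed

instance vec :: (topological_ab_group_add, finite) topological_ab_group_add ..

instance vec :: (t0_space, finite) t0_space
proof
  fix x y :: "('a, 'b) vec"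
  assume "x \<noteq> y"
  then obtain i where "x $ i \<noteq> y $ i"
    by (auto simp: vec_eq_iff)
  then obtain U where U: "open U" "\<not> (x $ i \<in> U \<longleftrightarrow> y $ i \<in> U)"
    by (meson separation_t0)
  show "\<exists>U. open U \<and> \<not> (x \<in> U \<longleftrightarrow> y \<in> U)"
  proof (rule exI, rule conjI)
    show "open ((\<lambda>z. z $ i) -` U)"
      using U(1) by (rule open_vimage_vec_nth)
    show "\<not> (x \<in> (\<lambda>z. z $ i) -` U \<longleftrightarrow> y \<in> (\<lambda>z. z $ i) -` U)"
      using U(2) by simp
  qed
qed

instance vec :: (t1_space, finite) t1_space
proof
  fix x y :: "('a, 'b) vec"
  assume "x \<noteq> y"
  then obtain i where "x $ i \<noteq> y $ i"
    by (auto simp: vec_eq_iff)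
  then obtain U where "open U" "x $ i \<in> U" "y $ i \<notin> U"
    using t1_space by blast
  then show "\<exists>U. open U \<and> x \<in> U \<and> y \<notin> U"
    by (intro exI[of _ "(\<lambda>z. z $ i) -` U"]) (auto intro: open_vimage_vec_nth)
qed

instance vec :: (t2_space, finite) t2_space
proof
  fix x y :: "('a, 'b) vec"
  assume "x \<noteq> y"
  then obtain i where "x $ i \<noteq> y $ i"
    by (auto simp: vec_eq_iff)
  then obtain U V where UV: "open U" "open V" "x $ i \<in> U" "y $ i \<in> V" "U \<inter> V = {}"
    using hausdorff by metis
  show "\<exists>U V. open U \<and> open V \<and> x \<in> U \<and> y \<in> V \<and> U \<inter> V = {}"
  proof (rule exI, rule exI, intro conjI)
    show "open ((\<lambda>z. z $ i) -` U)" "open ((\<lambda>z. z $ i) -` V)"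
      by (simp_all add: UV(1,2) open_vimage_vec_nth)
    show "x \<in> (\<lambda>z. z $ i) -` U" "y \<in> (\<lambda>z. z $ i) -` V"
      using UV(3,4) by simp_all
    show "(\<lambda>z. z $ i) -` U \<inter> (\<lambda>z. z $ i) -` V = {}"
      using UV(5) by blast
  qed
qed

instance vec :: (hausdorff_lcs, finite) hausdorff_lcs
proof
  fix a :: real and b :: "('a, 'b) vec"
  show "LIM x (nhds a \<times>\<^sub>F nhds b). fst x *\<^sub>R snd x :> nhds (a *\<^sub>R b)"
  proof (rule vec_tendstoI)
    fix i
    have "LIM x (nhds a \<times>\<^sub>F nhds b). (fst x, snd x $ i) :> nhds a \<times>\<^sub>F nhds (b $ i)"
      by (intro filterlim_Pair filterlim_fst tendsto_vec_nth filterlim_snd)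
    from filterlim_compose[OF tendsto_scaleR_Pair this]
    show "((\<lambda>x. (fst x *\<^sub>R snd x) $ i) \<longlongrightarrow> (a *\<^sub>R b) $ i) (nhds a \<times>\<^sub>F nhds b)"
      by simp
  qed
next
  fix U :: "('a, 'b) vec set"
  assume "open U" "0 \<in> U"
  then obtain A where A: "\<And>i. open (A i)" "\<And>i. 0 \<in> A i" "\<And>y. (\<forall>i. y $ i \<in> A i) \<Longrightarrow> y \<in> U"
    unfolding open_vec_def by (metis zero_index)
  have "\<exists>V. open V \<and> 0 \<in> V \<and> convex V \<and> V \<subseteq> A i" for i
    using convex_nhds_0 A(1,2) by blast
  then obtain V where V: "\<And>i. open (V i) \<and> 0 \<in> V i \<and> convex (V i) \<and> V i \<subseteq> A i"
    by metis
  have "open {y. \<forall>i. y $ i \<in> V i}"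
  proof (unfold open_vec_def, intro ballI exI conjI allI)
    fix x i
    assume "x \<in> {y. \<forall>i. y $ i \<in> V i}"
    then show "open (V i)" "x $ i \<in> V i"
      using V by auto
  qed auto
  moreover have "convex {y. \<forall>i. y $ i \<in> V i}"
    using V unfolding convex_def by simp
  moreover have "y \<in> U" if "\<forall>i. y $ i \<in> V i" for y
    using V A(3) that by blast
  ultimately show "\<exists>W. open W \<and> 0 \<in> W \<and>
      (\<forall>x\<in>W. \<forall>y\<in>W. \<forall>s\<ge>0. \<forall>t\<ge>0. s + t = 1 \<longrightarrow> s *\<^sub>R x + t *\<^sub>R y \<in> W) \<and> W \<subseteq> U"
    unfolding convex_def[symmetric]
    using V by (intro exI[of _ "{y. \<forall>i. y $ i \<in> V i}"]) (simp add: subset_iff)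
qed

definition curve_deriv :: "(real \<Rightarrow> 'b::hausdorff_lcs) \<Rightarrow> real \<Rightarrow> 'b" where
  "curve_deriv c t = Lim (at 0) (\<lambda>h. (c (t + h) - c t) /\<^sub>R h)"

definition gateaux :: "('a::real_vector \<Rightarrow> 'b::hausdorff_lcs) \<Rightarrow> 'a \<Rightarrow> 'a \<Rightarrow> 'b" where
  "gateaux X u v = curve_deriv (\<lambda>\<epsilon>. X (u + \<epsilon> *\<^sub>R v)) 0"

primrec iter_gateaux :: "('a::real_vector \<Rightarrow> 'b::hausdorff_lcs) \<Rightarrow> 'a list \<Rightarrow> 'a \<Rightarrow> 'b" where
  "iter_gateaux f [] = f"
| "iter_gateaux f (v # vs) = (\<lambda>u. gateaux (iter_gateaux f vs) u v)"

text \<open>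
  Smoothness in the sense of Michal, Bastiani and Hamilton: for every \<open>k\<close> the iterated Gateaux
  derivatives \<open>D\<^sup>k f(u)[v\<^sub>1, \<dots>, v\<^sub>k]\<close> exist at every point of the open set \<open>U\<close> and depend jointly
  continuously on \<open>u, v\<^sub>1, \<dots>, v\<^sub>k\<close>. The tuple of directions is given by the first \<open>k\<close> entries of a
  sequence \<open>w\<close>, so that its topology is the library's product topology on functions.
\<close>

definition smooth_on :: "'a::hausdorff_lcs set \<Rightarrow> ('a \<Rightarrow> 'b::hausdorff_lcs) \<Rightarrow> bool" where
  "smooth_on U f \<longleftrightarrow>
     (\<forall>vs. \<forall>u\<in>U. \<forall>v. \<exists>l.
        ((\<lambda>\<epsilon>. (iter_gateaux f vs (u + \<epsilon> *\<^sub>R v) - iter_gateaux f vs u) /\<^sub>R \<epsilon>) \<longlongrightarrow> l) (at 0)) \<and>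
     (\<forall>k. continuous_on (U \<times> UNIV)
        (\<lambda>(u, w :: nat \<Rightarrow> 'a). iter_gateaux f (map w [0..<k]) u))"

text \<open>
  Manifolds are open subsets \<open>M\<close> of a model space. The values of a vector field outside \<open>M\<close> are
  normalized to \<open>0\<close>, so that two vector fields on \<open>M\<close> are equal iff they agree on \<open>M\<close>.
\<close>

definition vector_fields :: "'a::hausdorff_lcs set \<Rightarrow> ('a \<Rightarrow> 'a) set" where
  "vector_fields M = {X. smooth_on M X \<and> (\<forall>u. u \<notin> M \<longrightarrow> X u = 0)}"

definition commutator :: "'a::hausdorff_lcs set \<Rightarrow> ('a \<Rightarrow> 'a) \<Rightarrow> ('a \<Rightarrow> 'a) \<Rightarrow> 'a \<Rightarrow> 'a" where
  "commutator M K S = (\<lambda>u. if u \<in> M then gateaux K u (S u) - gateaux S u (K u) else 0)"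

definition master_symmetry :: "nat \<Rightarrow> 'a::hausdorff_lcs set \<Rightarrow> ('a \<Rightarrow> 'a) \<Rightarrow> ('a \<Rightarrow> 'a) \<Rightarrow> bool" where
  "master_symmetry n M K \<sigma> \<longleftrightarrow>
     \<sigma> \<in> vector_fields M \<and> (commutator M K ^^ (n + 1)) \<sigma> = (\<lambda>_. 0)"

definition symmetry_algebra :: "'a::hausdorff_lcs set \<Rightarrow> ('a \<Rightarrow> 'a) \<Rightarrow> ('a \<Rightarrow> 'a) set" where
  "symmetry_algebra M K = {\<sigma> \<in> vector_fields M. commutator M K \<sigma> = (\<lambda>_. 0)}"

definition vf_subalgebra :: "'a::hausdorff_lcs set \<Rightarrow> ('a \<Rightarrow> 'a) set \<Rightarrow> bool" where
  "vf_subalgebra M A \<longleftrightarrow>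
     A \<subseteq> vector_fields M \<and> (\<lambda>_. 0) \<in> A \<and>
     (\<forall>X\<in>A. \<forall>Y\<in>A. \<forall>a b. (\<lambda>u. a *\<^sub>R X u + b *\<^sub>R Y u) \<in> A) \<and>
     (\<forall>X\<in>A. \<forall>Y\<in>A. commutator M X Y \<in> A)"

definition vf_algebra_iso ::
    "'a::hausdorff_lcs set \<Rightarrow> ('a \<Rightarrow> 'a) set \<Rightarrow> 'b::hausdorff_lcs set \<Rightarrow> ('b \<Rightarrow> 'b) set \<Rightarrow>
     (('a \<Rightarrow> 'a) \<Rightarrow> ('b \<Rightarrow> 'b)) \<Rightarrow> bool" where
  "vf_algebra_iso M A M' B \<phi> \<longleftrightarrow>
     vf_subalgebra M A \<and> vf_subalgebra M' B \<and> bij_betw \<phi> A B \<and>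
     (\<forall>X\<in>A. \<forall>Y\<in>A. \<forall>a b. \<phi> (\<lambda>u. a *\<^sub>R X u + b *\<^sub>R Y u) = (\<lambda>\<eta>. a *\<^sub>R \<phi> X \<eta> + b *\<^sub>R \<phi> Y \<eta>)) \<and>
     (\<forall>X\<in>A. \<forall>Y\<in>A. \<phi> (commutator M X Y) = commutator M' (\<phi> X) (\<phi> Y))"

text \<open>
  The block vector \<open>(\<eta>\<^sub>0, \<dots>, \<eta>\<^sub>N)\<close> has type \<open>'a ^ 'n\<close>, where \<open>'n\<close> is a finite linearly ordered type
  with \<open>N + 1\<close> elements; \<open>idx i\<close> is the number in \<open>{0..N}\<close> of the position \<open>i :: 'n\<close>.
\<close>

definition idx :: "'n::{finite,linorder} \<Rightarrow> nat" where
  "idx i = card {..<i}"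

lemma bij_betw_idx: "bij_betw idx (UNIV :: 'n::{finite,linorder} set) {..<CARD('n)}"
proof -
  have mono: "idx i < idx j" if "i < j" for i j :: 'n
    unfolding idx_def using that by (intro psubset_card_mono) auto
  then have inj: "inj (idx :: 'n \<Rightarrow> nat)"
    by (intro linorder_injI) (metis less_irrefl)
  moreover have "idx ` (UNIV :: 'n set) \<subseteq> {..<CARD('n)}"
  proof -
    have "idx i < CARD('n)" for i :: 'n
      unfolding idx_def by (rule psubset_card_mono) auto
    then show ?thesis by blast
  qed
  ultimately have "idx ` (UNIV :: 'n set) = {..<CARD('n)}"
    by (intro card_subset_eq) (auto simp: card_image)
  with inj show ?thesis
    by (simp add: bij_betw_def)
qed

lemma idx_Min: "idx (Min UNIV :: 'n::{finite,linorder}) = 0"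
  unfolding idx_def by (simp add: leD lessThan_def)

definition u_hat :: "'a::real_vector ^ 'n::{finite,linorder} \<Rightarrow> real \<Rightarrow> 'a" where
  "u_hat \<eta> \<epsilon> = (\<Sum>i\<in>UNIV. \<epsilon> ^ idx i *\<^sub>R (\<eta> $ i))"

text \<open>
  As \<open>M\<close> is open and \<open>\<eta>\<^sub>0\<close> is the value of \<open>u_hat \<eta>\<close> at \<open>0\<close>, the condition \<open>\<eta>\<^sub>0 \<in> M\<close> says precisely
  that \<open>u_hat \<eta> \<epsilon> \<in> M\<close> for all sufficiently small \<open>\<epsilon>\<close>.
\<close>

definition M_hat :: "'a set \<Rightarrow> ('a ^ 'n::{finite,linorder}) set" where
  "M_hat M = {\<eta>. \<eta> $ Min UNIV \<in> M}"

definition pert_field ::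
    "'a::hausdorff_lcs set \<Rightarrow> ('a \<Rightarrow> 'a) \<Rightarrow> 'a ^ 'n::{finite,linorder} \<Rightarrow> 'a ^ 'n::{finite,linorder}" where
  "pert_field M X = (\<lambda>\<eta>.
     if \<eta> \<in> M_hat M
     then (\<chi> i. (1 / fact (idx i)) *\<^sub>R (curve_deriv ^^ idx i) (\<lambda>\<epsilon>. X (u_hat \<eta> \<epsilon>)) 0)
     else 0)"

end

theory Submission
  imports Defs
begin

text \<open>
  Write \<open>F\<^sub>X(\<eta>, \<epsilon>) = X(u_hat \<eta> \<epsilon>)\<close>. The \<open>i\<close>-th component of the perturbation field of \<open>X\<close> is
  \<open>\<partial>\<^sub>\<epsilon>\<^sup>i F\<^sub>X / i!\<close> at \<open>\<epsilon> = 0\<close>, so it is smooth, and by symmetry of higher derivatives its derivative in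
  direction \<open>\<xi>\<close> is the \<open>i\<close>-th Taylor coefficient of \<open>\<epsilon> \<mapsto> X'(u_hat \<eta> \<epsilon>)[u_hat \<xi> \<epsilon>]\<close>. For \<open>\<xi>\<close> the
  perturbation field of \<open>S\<close> at \<open>\<eta>\<close>, the polynomial \<open>u_hat \<xi>\<close> is the Taylor polynomial of order \<open>N\<close> of
  \<open>\<epsilon> \<mapsto> S(u_hat \<eta> \<epsilon>)\<close>. As \<open>X'(u)[\<cdot>]\<close> is linear, replacing one curve by the other does not change the
  coefficients up to order \<open>N\<close>, so the commutator of the perturbation fields of \<open>K\<close> and \<open>S\<close> consists of
  the Taylor coefficients of \<open>\<epsilon> \<mapsto> [K, S](u_hat \<eta> \<epsilon>)\<close>. The assertions on master symmetries and
  symmetry algebras follow from this homomorphism property, its injectivity and the Jacobi identity.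
\<close>

section \<open>Products of locally convex spaces\<close>

text \<open>Model spaces carry no norm, so differential calculus is rebuilt from difference
  quotients: linearity of the derivative, symmetry of second derivatives and the chain rule all rest
  on a mean value estimate in convex open sets. Smoothness concerns iterated derivatives of every
  order, for which closed formulas are unwieldy; it is proved by exhibiting a class of functions
  that is closed under differentiation. Products enter because \<open>F\<^sub>X\<close> is treated
  as one smooth map of the pair \<open>(\<eta>, \<epsilon>)\<close>: Taylor coefficients are
  iterated derivatives in direction \<open>(0, 1)\<close>, a variation of \<eta> is a derivative in
  direction \<open>(\<xi>, 0)\<close>, and these can be exchanged. In general
  \<open>u_hat \<eta> \<epsilon>\<close> lies in \<open>M\<close> only for small \<epsilon>, so
  identities along such curves hold on an open set of parameters; as derivatives depend only on the
  behaviour near a point, this suffices. Truncation does no harm, since by the Leibniz rule the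
  coefficient of order \<open>i\<close> of \<open>K'(u_hat \<eta> \<epsilon>)[y(\<epsilon>)]\<close>
  involves the coefficients of \<open>y\<close> up to order \<open>i\<close> only.\<close>

instance prod :: (topological_monoid_add, topological_monoid_add) topological_monoid_add
proof
  fix a b :: "'a \<times> 'b"
  show "LIM x (nhds a \<times>\<^sub>F nhds b). fst x + snd x :> nhds (a + b)"
    unfolding plus_prod_def
    by (intro tendsto_Pair tendsto_add tendsto_fst tendsto_snd filterlim_fst filterlim_snd)
qed

instance prod :: (topological_group_add, topological_group_add) topological_group_add
proof
  fix a :: "'a \<times> 'b"
  show "(uminus \<longlongrightarrow> - a) (nhds a)"
    unfolding uminus_prod_def
    by (intro tendsto_Pair tendsto_minus tendsto_fst tendsto_snd filterlim_ident)
qed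

instance prod :: (topological_ab_group_add, topological_ab_group_add) topological_ab_group_add ..

lemma tendsto_scaleR_lcs:
  fixes g :: "'a \<Rightarrow> 'b::hausdorff_lcs"
  assumes "(f \<longlongrightarrow> a) F" "(g \<longlongrightarrow> b) F"
  shows "((\<lambda>x. f x *\<^sub>R g x) \<longlongrightarrow> a *\<^sub>R b) F"
  using filterlim_compose[OF tendsto_scaleR_Pair filterlim_Pair[OF assms]] by simp

lemma continuous_on_scaleR_lcs:
  fixes g :: "'a::topological_space \<Rightarrow> 'b::hausdorff_lcs"
  assumes "continuous_on S f" "continuous_on S g"
  shows "continuous_on S (\<lambda>x. f x *\<^sub>R g x)"
  using assms unfolding continuous_on_def by (auto intro: tendsto_scaleR_lcs)

instance prod :: (hausdorff_lcs, hausdorff_lcs) hausdorff_lcs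
proof
  fix a :: real and b :: "'a \<times> 'b"
  show "LIM x (nhds a \<times>\<^sub>F nhds b). fst x *\<^sub>R snd x :> nhds (a *\<^sub>R b)"
    unfolding scaleR_prod_def
    by (intro tendsto_Pair tendsto_scaleR_lcs tendsto_fst tendsto_snd filterlim_fst filterlim_snd)
next
  fix U :: "('a \<times> 'b) set"
  assume "open U" "0 \<in> U"
  then obtain A B where AB: "open A" "open B" "(0, 0) \<in> A \<times> B" "A \<times> B \<subseteq> U"
    by (metis open_prod_elim zero_prod_def)
  obtain V where V: "open V" "0 \<in> V" "convex V" "V \<subseteq> A"
    using convex_nhds_0[of A] AB by auto
  obtain W where W: "open W" "0 \<in> W" "convex W" "W \<subseteq> B"
    using convex_nhds_0[of B] AB by auto
  show "\<exists>V. open V \<and> 0 \<in> V \<and>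
      (\<forall>x\<in>V. \<forall>y\<in>V. \<forall>s\<ge>0. \<forall>t\<ge>0. s + t = 1 \<longrightarrow> s *\<^sub>R x + t *\<^sub>R y \<in> V) \<and> V \<subseteq> U"
    unfolding convex_def[symmetric]
    using V W AB(4) by (intro exI[of _ "V \<times> W"])
      (auto simp: open_Times zero_prod_def convex_Times)
qed

lemma convex_nhds:
  fixes a :: "'a::hausdorff_lcs"
  assumes "open U" "a \<in> U"
  obtains V where "open V" "a \<in> V" "convex V" "V \<subseteq> U"
proof -
  have tr: "open ((\<lambda>x. x + c) -` A)" if "open A" for A :: "'a set" and c
    using that by (intro open_vimage) (auto intro!: continuous_intros)
  obtain V where V: "open V" "0 \<in> V" "convex V" "V \<subseteq> (\<lambda>x. x + a) -` U"
    using convex_nhds_0[OF tr[OF assms(1), of a]] assms(2) by auto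
  \<comment> \<open>As a preimage under a translation the set is open, as an image under one it is
    convex.\<close>
  have eq: "(\<lambda>x. x + (- a)) -` V = (\<lambda>x. a + x) ` V"
  proof (intro set_eqI iffI)
    fix x assume "x \<in> (\<lambda>x. x + (- a)) -` V"
    then show "x \<in> (\<lambda>x. a + x) ` V" by (intro image_eqI[of _ _ "x - a"]) auto
  qed auto
  show ?thesis
  proof (rule that)
    show "open ((\<lambda>x. x + (- a)) -` V)" using V(1) by (rule tr)
    show "convex ((\<lambda>x. x + (- a)) -` V)" unfolding eq using V(3) by (rule convex_translation)
    show "(\<lambda>x. x + (- a)) -` V \<subseteq> U" unfolding eq using V(4) by (auto simp: add.commute)
    show "a \<in> (\<lambda>x. x + (- a)) -` V" using V(2) by simp
  qed
qed

text \<open>Mean value estimates place difference quotients in convex open sets only; local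
  convexity makes it enough to test a limit on these.\<close>

lemma tendsto_convexI:
  fixes a :: "'b::hausdorff_lcs"
  assumes "\<And>B. open B \<Longrightarrow> convex B \<Longrightarrow> a \<in> B \<Longrightarrow> eventually (\<lambda>x. f x \<in> B) F"
  shows "(f \<longlongrightarrow> a) F"
proof (rule topological_tendstoI)
  fix U assume "open U" "a \<in> U"
  then obtain V where V: "open V" "a \<in> V" "convex V" "V \<subseteq> U" by (rule convex_nhds)
  from assms[OF V(1,3,2)] show "eventually (\<lambda>x. f x \<in> U) F"
    by (rule eventually_mono) (use V(4) in auto)
qed

section \<open>Gateaux derivatives and the mean value theorem\<close>

text \<open>\<open>gateaux\<close> is built from \<open>Lim\<close> and has some value even where no
  limit exists; this relation also records existence.\<close>

definition has_gateaux :: "('a::real_vector \<Rightarrow> 'b::hausdorff_lcs) \<Rightarrow> 'a \<Rightarrow> 'a \<Rightarrow> 'b \<Rightarrow> bool" where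
  "has_gateaux f u v l \<longleftrightarrow> ((\<lambda>h. (f (u + h *\<^sub>R v) - f u) /\<^sub>R h) \<longlongrightarrow> l) (at 0)"

lemma gateaux_eqI: "has_gateaux f u v l \<Longrightarrow> gateaux f u v = l"
  unfolding has_gateaux_def gateaux_def curve_deriv_def by (intro tendsto_Lim) auto

lemma has_gateaux_cong:
  fixes f :: "'a::hausdorff_lcs \<Rightarrow> 'b::hausdorff_lcs"
  assumes "open U" "u \<in> U" "\<And>x. x \<in> U \<Longrightarrow> f x = g x"
  shows "has_gateaux f u v l \<longleftrightarrow> has_gateaux g u v l"
proof -
  have "((\<lambda>h. u + h *\<^sub>R v) \<longlongrightarrow> u + 0 *\<^sub>R v) (at 0)"
    by (intro tendsto_add tendsto_scaleR_lcs tendsto_const tendsto_ident_at)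
  then have "eventually (\<lambda>h. u + h *\<^sub>R v \<in> U) (at 0)"
    using assms(1,2) by (intro topological_tendstoD) auto
  then show ?thesis
    unfolding has_gateaux_def
    by (intro tendsto_cong, elim eventually_mono) (use assms in auto)
qed

text \<open>\<open>Lim\<close> is a definite description, so it is enough that both difference
  quotients have the same limits, including the case that there are none.\<close>

lemma gateaux_cong:
  fixes f :: "'a::hausdorff_lcs \<Rightarrow> 'b::hausdorff_lcs"
  assumes "open U" "u \<in> U" "\<And>x. x \<in> U \<Longrightarrow> f x = g x"
  shows "gateaux f u v = gateaux g u v"
proof -
  have "has_gateaux f u v l = has_gateaux g u v l" for l
    using assms by (rule has_gateaux_cong)
  then show ?thesis
    unfolding has_gateaux_def gateaux_def curve_deriv_def t2_space_class.Lim_def by (simp add: fun_eq_iff)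
qed

section \<open>The mean value theorem in convex open sets\<close>

text \<open>
  The model spaces need not be complete and no continuous functionals are used: by bisection it
  suffices to control difference quotients over short intervals around a single point, and those
  over adjacent intervals are combined by convexity.
\<close>

lemma mean_value_convex:
  fixes c :: "real \<Rightarrow> 'b::hausdorff_lcs"
  assumes "a \<le> b" "open B" "convex B"
    and der: "\<And>t. a \<le> t \<Longrightarrow> t \<le> b \<Longrightarrow> \<exists>l\<in>B. has_gateaux c t 1 l"
  shows "\<exists>y\<in>B. c b - c a = (b - a) *\<^sub>R y"
  using assms(1)
proof (induction rule: Bolzano)
  case (trans p q r)
  obtain y z where y: "y \<in> B" "c q - c p = (q - p) *\<^sub>R y" and z: "z \<in> B" "c r - c q = (r - q) *\<^sub>R z"
    using trans(1,2) by blast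
  show ?case
  proof (cases "p = r")
    case True
    then show ?thesis using y(1) by (intro bexI[of _ y]) simp_all
  next
    case False
    have "(q - p) / (r - p) + (r - q) / (r - p) = 1"
      using False by (simp add: add_divide_distrib[symmetric])
    then have "((q - p) / (r - p)) *\<^sub>R y + ((r - q) / (r - p)) *\<^sub>R z \<in> B"
      using trans(3,4) by (intro convexD[OF assms(3)] y z) simp_all
    moreover have "c r - c p = (r - p) *\<^sub>R (((q - p) / (r - p)) *\<^sub>R y + ((r - q) / (r - p)) *\<^sub>R z)"
    proof -
      have "c r - c p = (c q - c p) + (c r - c q)" by simp
      also have "\<dots> = (q - p) *\<^sub>R y + (r - q) *\<^sub>R z" by (simp only: y z)
      finally show ?thesis using False by (simp add: scaleR_add_right)
    qed
    ultimately show ?thesis by blast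
  qed
next
  case (local t)
  obtain l where l: "l \<in> B" "has_gateaux c t 1 l" using der local by blast
  have "eventually (\<lambda>h. (c (t + h *\<^sub>R 1) - c t) /\<^sub>R h \<in> B) (at 0)"
    using l assms(2) unfolding has_gateaux_def by (metis topological_tendstoD)
  then obtain d where "d > 0" "\<forall>h. h \<noteq> 0 \<and> dist h 0 < d \<longrightarrow> (c (t + h *\<^sub>R 1) - c t) /\<^sub>R h \<in> B"
    unfolding eventually_at by blast
  then have d: "d > 0" "\<And>h. h \<noteq> 0 \<Longrightarrow> \<bar>h\<bar> < d \<Longrightarrow> (c (t + h) - c t) /\<^sub>R h \<in> B"
    by simp_all
  have near: "\<exists>y\<in>B. c s - c t = (s - t) *\<^sub>R y" if "\<bar>s - t\<bar> < d" for s
  proof (cases "s = t")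
    case True
    then show ?thesis using l(1) by (intro bexI[of _ l]) simp_all
  next
    case False
    then have "(c (t + (s - t)) - c t) /\<^sub>R (s - t) \<in> B"
      using that by (intro d(2)) simp_all
    then have "(c s - c t) /\<^sub>R (s - t) \<in> B" by simp
    then show ?thesis using False by (intro bexI[of _ "(c s - c t) /\<^sub>R (s - t)"]) simp_all
  qed
  have "\<exists>y\<in>B. c q - c p = (q - p) *\<^sub>R y" if pq: "p \<le> t" "t \<le> q" "q - p < d" for p q
  proof -
    have "\<bar>p - t\<bar> < d" "\<bar>q - t\<bar> < d" using pq by linarith+
    from near[OF this(1)] near[OF this(2)] obtain y z where
      y: "y \<in> B" "c p - c t = (p - t) *\<^sub>R y" and z: "z \<in> B" "c q - c t = (q - t) *\<^sub>R z"
      by blast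
    show ?thesis
    proof (cases "p = q")
      case True
      then show ?thesis using y(1) by (intro bexI[of _ y]) simp_all
    next
      case False
      have "(t - p) / (q - p) + (q - t) / (q - p) = 1"
        using False by (simp add: add_divide_distrib[symmetric])
      then have "((t - p) / (q - p)) *\<^sub>R y + ((q - t) / (q - p)) *\<^sub>R z \<in> B"
        using pq by (intro convexD[OF assms(3)] y z) simp_all
      moreover have "c q - c p = (q - p) *\<^sub>R (((t - p) / (q - p)) *\<^sub>R y + ((q - t) / (q - p)) *\<^sub>R z)"
      proof -
        have "c q - c p = (c q - c t) - (c p - c t)" by simp
        also have "\<dots> = (q - t) *\<^sub>R z - (p - t) *\<^sub>R y" by (simp only: y z)
        also have "\<dots> = (t - p) *\<^sub>R y + (q - t) *\<^sub>R z"
          by (metis add.commute diff_conv_add_uminus minus_diff_eq scaleR_minus_left)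
        finally show ?thesis using False by (simp add: scaleR_add_right)
      qed
      ultimately show ?thesis by (rule bexI[rotated])
    qed
  qed
  then show ?case using d(1) by (intro exI[of _ d]) simp
qed

text \<open>The condition on \<open>\<bar>t\<bar>\<close> treats steps of both signs alike; for
  \<open>h < 0\<close> the mean value theorem is applied on \<open>[h, 0]\<close> and the two sign
  changes cancel.\<close>

lemma difference_quotient_in_convex:
  fixes c :: "real \<Rightarrow> 'b::hausdorff_lcs"
  assumes "open B" "convex B" "h \<noteq> 0"
    and "\<And>t. \<bar>t\<bar> \<le> \<bar>h\<bar> \<Longrightarrow> \<exists>l\<in>B. has_gateaux c t 1 l"
  shows "(c h - c 0) /\<^sub>R h \<in> B"
proof (cases "h > 0")
  case True
  have "\<exists>l\<in>B. has_gateaux c t 1 l" if "0 \<le> t" "t \<le> h" for t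
    by (rule assms(4)) (use that in linarith)
  then obtain y where y: "y \<in> B" "c h - c 0 = (h - 0) *\<^sub>R y"
    using mean_value_convex[OF less_imp_le[OF True] assms(1,2), of c] by blast
  then show ?thesis unfolding y(2) using True by simp
next
  case False
  then have "h \<le> 0" by simp
  have "\<exists>l\<in>B. has_gateaux c t 1 l" if "h \<le> t" "t \<le> 0" for t
    by (rule assms(4)) (use that in linarith)
  then obtain y where y: "y \<in> B" "c 0 - c h = (0 - h) *\<^sub>R y"
    using mean_value_convex[OF \<open>h \<le> 0\<close> assms(1,2), of c] by blast
  have "c h - c 0 = - (c 0 - c h)" by simp
  also have "\<dots> = h *\<^sub>R y" unfolding y(2) by simp
  finally have "c h - c 0 = h *\<^sub>R y" .
  then show ?thesis using y(1) assms(3) by simp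
qed

text \<open>Continuity is joint in point and direction, so no topology on a space of linear maps has
  to be chosen. All iterated derivatives of a smooth map have this property, hence what is proved
  for \<open>c1_on\<close> applies at every order.\<close>

definition c1_on :: "'a::hausdorff_lcs set \<Rightarrow> ('a \<Rightarrow> 'b::hausdorff_lcs) \<Rightarrow> bool" where
  "c1_on U f \<longleftrightarrow> (\<forall>u\<in>U. \<forall>v. has_gateaux f u v (gateaux f u v)) \<and>
     continuous_on (U \<times> UNIV) (\<lambda>(u, v). gateaux f u v)"

lemma c1_on_has_dd: "c1_on U f \<Longrightarrow> u \<in> U \<Longrightarrow> has_gateaux f u v (gateaux f u v)"
  unfolding c1_on_def by blast

lemma c1_on_tendsto_gateaux:
  assumes "c1_on U f" "open U" "u \<in> U" "(p \<longlongrightarrow> u) F" "(q \<longlongrightarrow> v) F"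
  shows "((\<lambda>x. gateaux f (p x) (q x)) \<longlongrightarrow> gateaux f u v) F"
proof -
  have "((\<lambda>x. (p x, q x)) \<longlongrightarrow> (u, v)) F" using assms by (intro tendsto_Pair)
  moreover have "((\<lambda>(u, v). gateaux f u v) \<longlongrightarrow> gateaux f u v) (nhds (u, v))"
  proof -
    have "isCont (\<lambda>(u, v). gateaux f u v) (u, v)"
      using assms(1-3) unfolding c1_on_def
      by (auto simp: continuous_on_eq_continuous_at open_Times)
    then show ?thesis
      using tendsto_at_iff_tendsto_nhds[of "\<lambda>(u, v). gateaux f u v" "(u, v)"]
      by (simp add: continuous_at)
  qed
  ultimately show ?thesis using filterlim_compose by fastforce
qed

lemma has_gateaux_shift:
  assumes "has_gateaux f (u + t *\<^sub>R v) v l"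
  shows "has_gateaux (\<lambda>t. f (u + t *\<^sub>R v)) t 1 l"
  using assms unfolding has_gateaux_def by (simp add: algebra_simps)

text \<open>Along short segments \<open>p x + t *\<^sub>R q x\<close> the derivative stays in a
  given convex neighbourhood of the limit, hence so does the difference quotient. That base point,
  direction and step may move together replaces uniform error estimates in a norm.\<close>

lemma strict_derivative:
  fixes f :: "'a::hausdorff_lcs \<Rightarrow> 'b::hausdorff_lcs"
  assumes f: "c1_on U f" "open U" "u \<in> U"
    and lim: "(p \<longlongrightarrow> u) F" "(q \<longlongrightarrow> v) F" "(h \<longlongrightarrow> 0) F"
    and nz: "eventually (\<lambda>x. h x \<noteq> 0) F"
  shows "((\<lambda>x. (f (p x + h x *\<^sub>R q x) - f (p x)) /\<^sub>R h x) \<longlongrightarrow> gateaux f u v) F"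
proof (rule tendsto_convexI)
  fix B assume B: "open B" "convex B" "gateaux f u v \<in> B"
  let ?G = "nhds (0::real) \<times>\<^sub>F (nhds u \<times>\<^sub>F nhds v)"
  have f0: "((\<lambda>(r, a, b). a + r *\<^sub>R b) \<longlongrightarrow> u + 0 *\<^sub>R v) ?G"
    and f1: "((\<lambda>(r, a, b). b) \<longlongrightarrow> v) ?G"
    unfolding case_prod_unfold
    by (intro tendsto_add tendsto_scaleR_lcs filterlim_fst filterlim_snd
        filterlim_compose[OF filterlim_fst filterlim_snd]
        filterlim_compose[OF filterlim_snd filterlim_snd])+
  have "((\<lambda>(r, a, b). gateaux f (a + r *\<^sub>R b) b) \<longlongrightarrow> gateaux f u v) ?G"
    using c1_on_tendsto_gateaux[OF f _ f1] f0 by (simp add: case_prod_unfold)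
  then have "eventually (\<lambda>(r, a, b). gateaux f (a + r *\<^sub>R b) b \<in> B) ?G"
    using topological_tendstoD[OF _ B(1) B(3)] by (fastforce simp: case_prod_unfold)
  moreover have "eventually (\<lambda>(r, a, b). a + r *\<^sub>R b \<in> U) ?G"
    using topological_tendstoD[OF f0 f(2)] f(3) by (simp add: case_prod_unfold)
  ultimately have "eventually (\<lambda>(r, a, b). a + r *\<^sub>R b \<in> U \<and> gateaux f (a + r *\<^sub>R b) b \<in> B) ?G"
    by eventually_elim auto
  \<comment> \<open>A product neighbourhood separates the step from point and direction: the bound
    must hold for all \<open>t\<close> with \<open>\<bar>t\<bar> \<le> \<bar>h x\<bar>\<close>, not
    only for the step \<open>h x\<close> itself.\<close>
  then obtain P Q where PQ: "eventually P (nhds 0)" "eventually Q (nhds u \<times>\<^sub>F nhds v)"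
      "\<And>r a b. P r \<Longrightarrow> Q (a, b) \<Longrightarrow> a + r *\<^sub>R b \<in> U \<and> gateaux f (a + r *\<^sub>R b) b \<in> B"
    unfolding eventually_prod_filter[of _ "nhds (0::real)"] by force
  obtain d where d: "d > 0" "\<And>r. \<bar>r\<bar> < d \<Longrightarrow> P r"
    using PQ(1) unfolding eventually_nhds_metric by (auto simp: dist_real_def)
  have "eventually (\<lambda>x. Q (p x, q x)) F"
    using filterlim_Pair[OF lim(1,2)] PQ(2) by (auto simp: filterlim_iff)
  moreover have "eventually (\<lambda>x. \<bar>h x\<bar> < d) F"
    using tendstoD[OF lim(3) d(1)] by (simp add: dist_real_def)
  ultimately show "eventually (\<lambda>x. (f (p x + h x *\<^sub>R q x) - f (p x)) /\<^sub>R h x \<in> B) F"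
    using nz
  proof eventually_elim
    case (elim x)
    have "\<exists>l\<in>B. has_gateaux (\<lambda>t. f (p x + t *\<^sub>R q x)) t 1 l" if "\<bar>t\<bar> \<le> \<bar>h x\<bar>" for t
    proof -
      have "P t" using d that elim by auto
      with PQ(3) elim f(1) show ?thesis
        by (intro bexI[of _ "gateaux f (p x + t *\<^sub>R q x) (q x)"] has_gateaux_shift c1_on_has_dd) auto
    qed
    from difference_quotient_in_convex[OF B(1,2) elim(3) this] show ?case by simp
  qed
qed

text \<open>The increment along \<open>v + w\<close> passes through
  \<open>u + h *\<^sub>R w\<close>, so its part along \<open>v\<close> starts at a moving base
  point; this calls for the strict derivative.\<close>

lemma gateaux_add:
  assumes f: "c1_on U f" "open U" "u \<in> U"
  shows "gateaux f u (v + w) = gateaux f u v + gateaux f u w"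
proof (rule gateaux_eqI)
  have l: "((\<lambda>h. u + h *\<^sub>R w) \<longlongrightarrow> u) (at 0)"
    using tendsto_add[OF tendsto_const tendsto_scaleR_lcs[OF tendsto_ident_at tendsto_const], of u w 0 UNIV]
    by simp
  have "((\<lambda>h. (f ((u + h *\<^sub>R w) + h *\<^sub>R v) - f (u + h *\<^sub>R w)) /\<^sub>R h
      + (f (u + h *\<^sub>R w) - f u) /\<^sub>R h) \<longlongrightarrow> gateaux f u v + gateaux f u w) (at 0)"
    using c1_on_has_dd[OF f(1,3)] unfolding has_gateaux_def
    by (intro tendsto_add strict_derivative[OF f l]) (auto intro: eventually_neq_at_within)
  then show "has_gateaux f u (v + w) (gateaux f u v + gateaux f u w)"
    unfolding has_gateaux_def by (simp add: algebra_simps)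
qed

lemma gateaux_scaleR:
  assumes f: "c1_on U f" "open U" "u \<in> U"
  shows "gateaux f u (a *\<^sub>R v) = a *\<^sub>R gateaux f u v"
proof (rule gateaux_eqI, cases "a = 0")
  case True
  then show "has_gateaux f u (a *\<^sub>R v) (a *\<^sub>R gateaux f u v)" by (simp add: has_gateaux_def)
next
  case False
  have "((\<lambda>h::real. h * a) \<longlongrightarrow> 0 * a) (at 0)"
    by (intro tendsto_intros)
  then have "((\<lambda>h. a *\<^sub>R ((f (u + (h * a) *\<^sub>R v) - f u) /\<^sub>R (h * a))) \<longlongrightarrow> a *\<^sub>R gateaux f u v) (at 0)"
    using False by (intro tendsto_scaleR_lcs strict_derivative[OF f] tendsto_const)
      (auto simp: eventually_neq_at_within)
  moreover have "a * (inverse h * inverse a) = inverse h" for h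
    using False by (simp add: mult.left_commute)
  ultimately show "has_gateaux f u (a *\<^sub>R v) (a *\<^sub>R gateaux f u v)"
    by (simp add: has_gateaux_def)
qed

text \<open>
  Both mixed derivatives are the limit of the second difference quotient with equal step sizes,
  which is symmetric in \<open>v\<close> and \<open>w\<close>.
\<close>

lemma gateaux_commute:
  assumes f: "c1_on U f" "open U" "u \<in> U"
    and v: "c1_on U (\<lambda>x. gateaux f x v)" and w: "c1_on U (\<lambda>x. gateaux f x w)"
  shows "gateaux (\<lambda>x. gateaux f x v) u w = gateaux (\<lambda>x. gateaux f x w) u v"
proof -
  have lim: "((\<lambda>h. (f (u + h *\<^sub>R v + h *\<^sub>R w) - f (u + h *\<^sub>R v) - f (u + h *\<^sub>R w) + f u) /\<^sub>R (h * h))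
      \<longlongrightarrow> gateaux (\<lambda>x. gateaux f x v) u w) (at 0)"
    if "c1_on U (\<lambda>x. gateaux f x v)" for v w
  proof (rule tendsto_convexI)
    fix B assume B: "open B" "convex B" "gateaux (\<lambda>x. gateaux f x v) u w \<in> B"
    \<comment> \<open>\<open>s\<close> runs over a whole interval around \<open>0\<close> and may
      vanish, whereas \<open>t\<close> is the nonzero step by which the quotient divides.\<close>
    let ?G = "nhds (0::real) \<times>\<^sub>F at (0::real)"
    have l1: "(fst \<longlongrightarrow> 0) ?G" and l2: "(snd \<longlongrightarrow> 0) ?G"
      using filterlim_snd[of "at (0::real)" "nhds (0::real)"]
      by (auto simp: filterlim_fst filterlim_at)
    have nz: "eventually (\<lambda>x. snd x \<noteq> 0) ?G"
      using filterlim_snd[of "at (0::real)" "nhds (0::real)"] by (auto simp: filterlim_at)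
    have m1: "((\<lambda>x. u + fst x *\<^sub>R v) \<longlongrightarrow> u) ?G"
      using tendsto_add[OF tendsto_const tendsto_scaleR_lcs[OF l1 tendsto_const], of u v] by simp
    have m2: "((\<lambda>x. u + fst x *\<^sub>R v + snd x *\<^sub>R w) \<longlongrightarrow> u) ?G"
      using tendsto_add[OF m1 tendsto_scaleR_lcs[OF l2 tendsto_const], of w] by simp
    have "eventually (\<lambda>x. (gateaux f (u + fst x *\<^sub>R v + snd x *\<^sub>R w) v - gateaux f (u + fst x *\<^sub>R v) v)
        /\<^sub>R snd x \<in> B) ?G"
      by (intro topological_tendstoD[OF strict_derivative[OF that f(2,3) m1 tendsto_const l2 nz]] B)
    moreover have "eventually (\<lambda>x. u + fst x *\<^sub>R v \<in> U) ?G" "eventually (\<lambda>x. u + fst x *\<^sub>R v + snd x *\<^sub>R w \<in> U) ?G"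
      using m1 m2 f by (auto intro: topological_tendstoD)
    ultimately have "eventually (\<lambda>(s, t). u + s *\<^sub>R v \<in> U \<and> u + s *\<^sub>R v + t *\<^sub>R w \<in> U \<and>
        (gateaux f (u + s *\<^sub>R v + t *\<^sub>R w) v - gateaux f (u + s *\<^sub>R v) v) /\<^sub>R t \<in> B) ?G"
      by eventually_elim auto
    then obtain P Q where PQ: "eventually P (nhds 0)" "eventually Q (at 0)"
      "\<And>s t. P s \<Longrightarrow> Q t \<Longrightarrow> u + s *\<^sub>R v \<in> U \<and> u + s *\<^sub>R v + t *\<^sub>R w \<in> U \<and>
        (gateaux f (u + s *\<^sub>R v + t *\<^sub>R w) v - gateaux f (u + s *\<^sub>R v) v) /\<^sub>R t \<in> B"
      unfolding eventually_prod_filter by auto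
    obtain d where d: "d > 0" "\<And>r. \<bar>r\<bar> < d \<Longrightarrow> P r"
      using PQ(1) unfolding eventually_nhds_metric by (auto simp: dist_real_def)
    have "eventually (\<lambda>h. \<bar>h\<bar> < d) (at (0::real))"
      using d(1) by (auto simp: eventually_at dist_real_def)
    then show "eventually (\<lambda>h. (f (u + h *\<^sub>R v + h *\<^sub>R w) - f (u + h *\<^sub>R v) - f (u + h *\<^sub>R w) + f u)
        /\<^sub>R (h * h) \<in> B) (at 0)"
      using PQ(2) eventually_neq_at_within[of 0]
    proof eventually_elim
      case (elim h)
      \<comment> \<open>The derivative of \<open>c\<close> is the difference quotient in direction
        \<open>w\<close> of the first derivative along \<open>v\<close>, while
        \<open>(c h - c 0) /\<^sub>R h\<close> is the second difference quotient of
        \<open>f\<close>.\<close>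
      define c where "c = (\<lambda>s. (f (u + h *\<^sub>R w + s *\<^sub>R v) - f (u + s *\<^sub>R v)) /\<^sub>R h)"
      have "\<exists>l\<in>B. has_gateaux c s 1 l" if "\<bar>s\<bar> \<le> \<bar>h\<bar>" for s
      proof -
        have "P s" using d that elim by auto
        with PQ(3) elim have *: "u + s *\<^sub>R v \<in> U" "u + h *\<^sub>R w + s *\<^sub>R v \<in> U"
          "(gateaux f (u + h *\<^sub>R w + s *\<^sub>R v) v - gateaux f (u + s *\<^sub>R v) v) /\<^sub>R h \<in> B"
          by (simp_all add: add.assoc add.commute[of "h *\<^sub>R w"])
        have "((\<lambda>k. ((f (u + h *\<^sub>R w + (s + k *\<^sub>R 1) *\<^sub>R v) - f (u + h *\<^sub>R w + s *\<^sub>R v)) /\<^sub>R k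
            - (f (u + (s + k *\<^sub>R 1) *\<^sub>R v) - f (u + s *\<^sub>R v)) /\<^sub>R k) /\<^sub>R h)
          \<longlongrightarrow> (gateaux f (u + h *\<^sub>R w + s *\<^sub>R v) v - gateaux f (u + s *\<^sub>R v) v) /\<^sub>R h) (at 0)"
          using has_gateaux_shift[OF c1_on_has_dd[OF f(1) *(1), of v]]
            has_gateaux_shift[OF c1_on_has_dd[OF f(1) *(2), of v]]
          unfolding has_gateaux_def by (intro tendsto_scaleR_lcs tendsto_const tendsto_diff)
        then have "has_gateaux c s 1 ((gateaux f (u + h *\<^sub>R w + s *\<^sub>R v) v - gateaux f (u + s *\<^sub>R v) v) /\<^sub>R h)"
          unfolding has_gateaux_def c_def by (simp add: algebra_simps)
        with * show ?thesis by blast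
      qed
      from difference_quotient_in_convex[OF B(1,2) elim(3) this] show ?case
        unfolding c_def by (simp add: algebra_simps)
    qed
  qed
  have "((\<lambda>h. (f (u + h *\<^sub>R v + h *\<^sub>R w) - f (u + h *\<^sub>R v) - f (u + h *\<^sub>R w) + f u) /\<^sub>R (h * h))
      \<longlongrightarrow> gateaux (\<lambda>x. gateaux f x w) u v) (at 0)"
    using lim[OF w, of v] by (simp add: algebra_simps)
  with lim[OF v, of w] show ?thesis
    by (rule tendsto_unique[rotated]) simp
qed

section \<open>Smooth maps\<close>

lemma tendsto_componentwise_fun:
  fixes f :: "'x \<Rightarrow> 'i \<Rightarrow> 'a::topological_space"
  assumes "\<And>i. ((\<lambda>x. f x i) \<longlongrightarrow> l i) F"
  shows "(f \<longlongrightarrow> l) F"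
  using assms limitin_componentwise[of "\<lambda>_. euclidean" UNIV f l F]
  by (simp add: euclidean_product_topology)

section \<open>Elementary differentiation rules\<close>

lemma has_gateaux_const: "has_gateaux (\<lambda>_. c) u v 0"
  by (simp add: has_gateaux_def)

lemma has_gateaux_add:
  assumes "has_gateaux f u v a" "has_gateaux g u v b"
  shows "has_gateaux (\<lambda>x. f x + g x) u v (a + b)"
  using tendsto_add[OF assms[unfolded has_gateaux_def]] unfolding has_gateaux_def
  by (simp add: algebra_simps)

lemma has_gateaux_scaleR:
  assumes "has_gateaux f u v a"
  shows "has_gateaux (\<lambda>x. c *\<^sub>R f x) u v (c *\<^sub>R a)"
  using tendsto_scaleR_lcs[OF tendsto_const assms[unfolded has_gateaux_def], of c] unfolding has_gateaux_def
  by (simp add: algebra_simps)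

lemma has_gateaux_diff:
  assumes "has_gateaux f u v a" "has_gateaux g u v b"
  shows "has_gateaux (\<lambda>x. f x - g x) u v (a - b)"
  using tendsto_diff[OF assms[unfolded has_gateaux_def]] unfolding has_gateaux_def
  by (simp add: algebra_simps)

lemma has_gateaux_tendsto:
  assumes "has_gateaux f u v a"
  shows "((\<lambda>h. f (u + h *\<^sub>R v)) \<longlongrightarrow> f u) (at 0)"
proof -
  have "((\<lambda>h. f u + h *\<^sub>R ((f (u + h *\<^sub>R v) - f u) /\<^sub>R h)) \<longlongrightarrow> f u + 0 *\<^sub>R a) (at 0)"
    using assms unfolding has_gateaux_def
    by (intro tendsto_add tendsto_scaleR_lcs tendsto_const tendsto_ident_at)
  moreover have "eventually (\<lambda>h. f u + h *\<^sub>R ((f (u + h *\<^sub>R v) - f u) /\<^sub>R h) = f (u + h *\<^sub>R v)) (at 0)"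
    using eventually_neq_at_within[of 0] by eventually_elim simp
  ultimately have "((\<lambda>h. f (u + h *\<^sub>R v)) \<longlongrightarrow> f u + 0 *\<^sub>R a) (at 0)"
    by (rule Lim_transform_eventually)
  then show ?thesis by simp
qed

section \<open>Iterated derivatives: joint continuity, multilinearity and the chain rule\<close>

lemma smooth_on_continuous:
  fixes f :: "'a::hausdorff_lcs \<Rightarrow> 'b::hausdorff_lcs"
  assumes "smooth_on U f"
  shows "continuous_on (U \<times> UNIV) (\<lambda>(u, w :: nat \<Rightarrow> 'a). iter_gateaux f (map w [0..<k]) u)"
  by (rule spec[OF conjunct2[OF assms[unfolded smooth_on_def]]])

lemma smooth_on_has_dd:
  assumes "smooth_on U f" "u \<in> U"
  shows "has_gateaux (iter_gateaux f vs) u v (iter_gateaux f (v # vs) u)"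
proof -
  obtain l where l: "has_gateaux (iter_gateaux f vs) u v l"
    using spec[OF bspec[OF spec[OF conjunct1[OF assms(1)[unfolded smooth_on_def]]] assms(2)]]
    unfolding has_gateaux_def by (rule exE)
  show ?thesis using gateaux_eqI[OF l] l by simp
qed

text \<open>Turns the continuity clause of \<open>smooth_on\<close>, which speaks of sequences, into
  one for a list of directions that depend on the point.\<close>

lemma smooth_on_continuous_iter:
  assumes f: "smooth_on V f" and p: "continuous_on S p" "p ` S \<subseteq> V"
    and b: "\<And>i. i \<in> set is \<Longrightarrow> continuous_on S (b i)"
  shows "continuous_on S (\<lambda>x. iter_gateaux f (map (\<lambda>i. b i x) is) (p x))"
proof -
  \<comment> \<open>Entries beyond the list are never read; the value \<open>0\<close> keeps every
    coordinate of the sequence continuous.\<close>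
  let ?w = "\<lambda>x k. if k < length is then b (is ! k) x else 0"
  have "continuous_on S (\<lambda>x. ?w x k)" for k
    using b by (cases "k < length is") auto
  then have w: "continuous_on S (\<lambda>x. (p x, ?w x))"
    by (intro continuous_on_Pair p(1) continuous_on_coordinatewise_then_product) simp
  have sub: "(\<lambda>x. (p x, ?w x)) ` S \<subseteq> V \<times> UNIV"
    using p(2) by auto
  have "map (?w x) [0..<length is] = map (\<lambda>i. b i x) is" for x
    by (rule nth_equalityI) simp_all
  with continuous_on_compose2[OF smooth_on_continuous[OF f, of "length is"] w sub]
  show ?thesis by (simp only: case_prod_conv)
qed

lemma smooth_on_tendsto_iter:
  assumes f: "smooth_on V f" "open V" and p: "(p \<longlongrightarrow> u) F" "u \<in> V"
    and b: "\<And>i. i \<in> set is \<Longrightarrow> (b i \<longlongrightarrow> l i) F"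
  shows "((\<lambda>x. iter_gateaux f (map (\<lambda>i. b i x) is) (p x)) \<longlongrightarrow> iter_gateaux f (map l is) u) F"
proof -
  let ?w = "\<lambda>x k. if k < length is then b (is ! k) x else 0"
  let ?l = "\<lambda>k. if k < length is then l (is ! k) else 0"
  let ?f = "\<lambda>(u, w). iter_gateaux f (map w [0..<length is]) u"
  have "((\<lambda>x. ?w x k) \<longlongrightarrow> ?l k) F" for k
    using b by (cases "k < length is") auto
  then have lim: "((\<lambda>x. (p x, ?w x)) \<longlongrightarrow> (u, ?l)) F"
    by (intro tendsto_Pair p tendsto_componentwise_fun)
  have "(?f \<longlongrightarrow> ?f (u, ?l)) (at (u, ?l) within V \<times> UNIV)"
    using p(2) smooth_on_continuous[OF f(1)] unfolding continuous_on_def by blast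
  moreover have "at (u, ?l) within V \<times> UNIV = at (u, ?l)"
    by (rule at_within_open) (auto intro: open_Times f(2) p(2))
  \<comment> \<open>A limit along the full filter \<open>nhds\<close> is required, since
    \<open>p x\<close> and the directions may attain their limits.\<close>
  ultimately have "(?f \<longlongrightarrow> ?f (u, ?l)) (nhds (u, ?l))"
    by (metis (no_types, lifting) tendsto_at_iff_tendsto_nhds)
  from filterlim_compose[OF this lim]
  have "((\<lambda>x. ?f (p x, ?w x)) \<longlongrightarrow> ?f (u, ?l)) F" .
  moreover have "map (?w x) [0..<length is] = map (\<lambda>i. b i x) is" for x
    by (rule nth_equalityI) simp_all
  moreover have "map ?l [0..<length is] = map l is"
    by (rule nth_equalityI) simp_all
  ultimately show ?thesis by simp
qed

lemma smooth_on_c1_on: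
  assumes "smooth_on U f"
  shows "c1_on U (iter_gateaux f vs)"
  unfolding c1_on_def
proof (intro conjI ballI allI)
  show "has_gateaux (iter_gateaux f vs) u v (gateaux (iter_gateaux f vs) u v)" if "u \<in> U" for u v
    using smooth_on_has_dd[OF assms that] by simp
  \<comment> \<open>The outermost direction is the variable \<open>snd\<close>; those in
    \<open>vs\<close> become constant functions.\<close>
  let ?is = "snd # map (\<lambda>v _. v) vs"
  have "continuous_on (U \<times> UNIV) (\<lambda>x. iter_gateaux f (map (\<lambda>i. i x) ?is) (fst x))"
    by (rule smooth_on_continuous_iter[OF assms]) (auto intro!: continuous_intros)
  then show "continuous_on (U \<times> UNIV) (\<lambda>(u, v). gateaux (iter_gateaux f vs) u v)"
    by (simp add: case_prod_unfold comp_def)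
qed

lemma smooth_on_c1_on_self: "smooth_on U f \<Longrightarrow> c1_on U f"
  using smooth_on_c1_on[of U f "[]"] by simp

text \<open>Additivity of the derivative taken in this slot is \<open>gateaux_add\<close>; the outer
  derivatives \<open>xs\<close> preserve the identity because it holds on the whole open set
  \<open>U\<close>.\<close>

lemma iter_gateaux_add:
  assumes f: "smooth_on U f" "open U" and "u \<in> U"
  shows "iter_gateaux f (xs @ (v + w) # ys) u
    = iter_gateaux f (xs @ v # ys) u + iter_gateaux f (xs @ w # ys) u"
  using assms(3)
proof (induction xs arbitrary: u)
  case Nil
  then show ?case
    using gateaux_add[OF smooth_on_c1_on[OF f(1)] f(2)] by simp
next
  case (Cons z xs)
  have "gateaux (iter_gateaux f (xs @ (v + w) # ys)) u z
      = gateaux (\<lambda>u. iter_gateaux f (xs @ v # ys) u + iter_gateaux f (xs @ w # ys) u) u z"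
    by (intro gateaux_cong[OF f(2)] Cons)
  also have "\<dots> = iter_gateaux f (z # xs @ v # ys) u + iter_gateaux f (z # xs @ w # ys) u"
    using Cons.prems by (intro gateaux_eqI has_gateaux_add smooth_on_has_dd[OF f(1)])
  finally show ?case by simp
qed

lemma iter_gateaux_scaleR:
  assumes f: "smooth_on U f" "open U" and "u \<in> U"
  shows "iter_gateaux f (xs @ (a *\<^sub>R v) # ys) u = a *\<^sub>R iter_gateaux f (xs @ v # ys) u"
  using assms(3)
proof (induction xs arbitrary: u)
  case Nil
  then show ?case
    using gateaux_scaleR[OF smooth_on_c1_on[OF f(1)] f(2)] by simp
next
  case (Cons z xs)
  have "gateaux (iter_gateaux f (xs @ (a *\<^sub>R v) # ys)) u z
      = gateaux (\<lambda>u. a *\<^sub>R iter_gateaux f (xs @ v # ys) u) u z"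
    by (intro gateaux_cong[OF f(2)] Cons)
  also have "\<dots> = a *\<^sub>R iter_gateaux f (z # xs @ v # ys) u"
    using Cons.prems by (intro gateaux_eqI has_gateaux_scaleR smooth_on_has_dd[OF f(1)])
  finally show ?case by simp
qed

lemma iter_gateaux_difference_quotient:
  assumes "smooth_on U f" "open U" "u \<in> U"
  shows "(iter_gateaux f (xs @ v # ys) u - iter_gateaux f (xs @ w # ys) u) /\<^sub>R h
    = iter_gateaux f (xs @ ((v - w) /\<^sub>R h) # ys) u"
  using iter_gateaux_add[OF assms, of xs "v - w" w ys]
  by (simp add: iter_gateaux_scaleR[OF assms])

text \<open>Chain rule and product rule at once. In the induction over \<open>js\<close>, the list
  \<open>us\<close> collects the directions that are held constant; in the base case only the point
  \<open>p x\<close> moves.\<close>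

lemma has_gateaux_iter_compose:
  fixes p :: "'e::hausdorff_lcs \<Rightarrow> 'a::hausdorff_lcs"
  assumes f: "smooth_on V f" "open V" and u: "p u \<in> V" and p: "has_gateaux p u v p'"
    and b: "\<And>i. i \<in> set js \<Longrightarrow> has_gateaux (b i) u v (b' i)"
  shows "has_gateaux (\<lambda>x. iter_gateaux f (us @ map (\<lambda>i. b i x) js) (p x)) u v
    (iter_gateaux f (p' # us @ map (\<lambda>i. b i u) js) (p u)
      + (\<Sum>k<length js. iter_gateaux f (us @ (map (\<lambda>i. b i u) js)[k := b' (js ! k)]) (p u)))"
  using b
proof (induction js arbitrary: us)
  case Nil
  \<comment> \<open>For \<open>h \<noteq> 0\<close> the moved point is
    \<open>p u + h *\<^sub>R ?q h\<close>, where \<open>?q h\<close> tends to \<open>p'\<close>: a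
    strict derivative with a moving direction.\<close>
  let ?q = "\<lambda>h. (p (u + h *\<^sub>R v) - p u) /\<^sub>R h"
  have "((\<lambda>h. (iter_gateaux f us (p u + h *\<^sub>R ?q h) - iter_gateaux f us (p u)) /\<^sub>R h)
      \<longlongrightarrow> gateaux (iter_gateaux f us) (p u) p') (at 0)"
    using p unfolding has_gateaux_def
    by (intro strict_derivative[OF smooth_on_c1_on[OF f(1)] f(2) u] tendsto_const
        tendsto_ident_at eventually_neq_at_within)
  moreover have "eventually (\<lambda>h. (iter_gateaux f us (p u + h *\<^sub>R ?q h) - iter_gateaux f us (p u)) /\<^sub>R h
      = (iter_gateaux f us (p (u + h *\<^sub>R v)) - iter_gateaux f us (p u)) /\<^sub>R h) (at 0)"
    using eventually_neq_at_within[of 0] by eventually_elim simp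
  ultimately have "((\<lambda>h. (iter_gateaux f us (p (u + h *\<^sub>R v)) - iter_gateaux f us (p u)) /\<^sub>R h)
      \<longlongrightarrow> gateaux (iter_gateaux f us) (p u) p') (at 0)"
    by (rule Lim_transform_eventually)
  then show ?case
    unfolding has_gateaux_def by simp
next
  case (Cons j js)
  let ?c = "\<lambda>h. u + h *\<^sub>R v" and ?m = "\<lambda>x. map (\<lambda>i. b i x) js"
  let ?q = "\<lambda>h. (b j (?c h) - b j u) /\<^sub>R h"
  let ?L = "map (\<lambda>v _. v) us @ ?q # map (\<lambda>i h. b i (?c h)) js"
  \<comment> \<open>\<open>l\<close> assigns to a function its limit, so that the list of limits
    takes the form \<open>map l ?L\<close> required by
    \<open>smooth_on_tendsto_iter\<close>.\<close>
  define l where "l = (\<lambda>g. Lim (at (0::real)) g :: 'a)"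
  have lL: "(g \<longlongrightarrow> l g) (at 0) \<and> l g = a" if "(g \<longlongrightarrow> a) (at 0)" for g a
    using that tendsto_Lim[OF _ that] unfolding l_def by simp
  have lc: "l (\<lambda>_. a) = a" for a using lL[of "\<lambda>_. a" a] by simp
  have q: "(?q \<longlongrightarrow> b' j) (at 0)" using Cons.prems[of j] by (simp add: has_gateaux_def)
  have bt: "((\<lambda>h. b i (?c h)) \<longlongrightarrow> b i u) (at 0)" if "i \<in> set js" for i
    using Cons.prems[of i] that by (intro has_gateaux_tendsto) auto
  have pt: "((\<lambda>h. p (?c h)) \<longlongrightarrow> p u) (at 0)" using p by (rule has_gateaux_tendsto)
  have "((\<lambda>h. iter_gateaux f (map (\<lambda>g. g h) ?L) (p (?c h))) \<longlongrightarrow> iter_gateaux f (map l ?L) (p u)) (at 0)"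
    using lL[OF q] lL[OF bt] lc by (intro smooth_on_tendsto_iter[OF f pt u]) auto
  moreover have "map (\<lambda>g. g h) ?L = us @ ?q h # ?m (?c h)" for h
    by (simp add: comp_def)
  moreover have "map l ?L = us @ b' j # ?m u"
    using lL[OF q] lL[OF bt] by (simp add: comp_def lc)
  ultimately have first: "((\<lambda>h. iter_gateaux f (us @ ?q h # ?m (?c h)) (p (?c h)))
      \<longlongrightarrow> iter_gateaux f (us @ b' j # ?m u) (p u)) (at 0)"
    by (simp only:)
  have "eventually (\<lambda>h. p (?c h) \<in> V) (at 0)"
    using topological_tendstoD[OF pt f(2) u] .
  then have "eventually (\<lambda>h. iter_gateaux f (us @ ?q h # ?m (?c h)) (p (?c h)) =
      (iter_gateaux f (us @ b j (?c h) # ?m (?c h)) (p (?c h))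
        - iter_gateaux f (us @ b j u # ?m (?c h)) (p (?c h))) /\<^sub>R h) (at 0)"
    by eventually_elim (simp only: iter_gateaux_difference_quotient[OF f])
  from Lim_transform_eventually[OF first this]
  have first: "((\<lambda>h. (iter_gateaux f (us @ b j (?c h) # ?m (?c h)) (p (?c h))
        - iter_gateaux f (us @ b j u # ?m (?c h)) (p (?c h))) /\<^sub>R h)
      \<longlongrightarrow> iter_gateaux f (us @ b' j # ?m u) (p u)) (at 0)"
    .
  \<comment> \<open>Telescoping: with its value frozen at \<open>u\<close>, the head joins the
    constant directions, and the induction hypothesis covers the remaining change.\<close>
  have "((\<lambda>h. (iter_gateaux f ((us @ [b j u]) @ ?m (?c h)) (p (?c h))
      - iter_gateaux f ((us @ [b j u]) @ ?m u) (p u)) /\<^sub>R h)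
      \<longlongrightarrow> iter_gateaux f (p' # (us @ [b j u]) @ ?m u) (p u)
        + (\<Sum>k<length js. iter_gateaux f ((us @ [b j u]) @ (?m u)[k := b' (js ! k)]) (p u))) (at 0)"
    using Cons.IH[of "us @ [b j u]"] Cons.prems unfolding has_gateaux_def by simp
  note tendsto_add[OF first this]
  moreover have "(x - y) /\<^sub>R h + (y - z) /\<^sub>R h = (x - z) /\<^sub>R h" for x y z :: 'b and h
    by (simp flip: scaleR_add_right)
  ultimately show ?case
    unfolding has_gateaux_def
    by (simp add: sum.lessThan_Suc_shift add.left_commute del: iter_gateaux.simps sum.lessThan_Suc)
qed

section \<open>A criterion for smoothness, and composition\<close>

text \<open>
  A coinduction principle: \<open>P\<close> is a class of functions of a point and a sequence \<open>w\<close> of directions that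
  is closed under differentiation in the direction of any entry of \<open>w\<close>.
\<close>

lemma smooth_onI_family:
  fixes f :: "'a::hausdorff_lcs \<Rightarrow> 'b::hausdorff_lcs" and g0 :: "'a \<Rightarrow> (nat \<Rightarrow> 'a) \<Rightarrow> 'b"
  assumes U: "open U"
    and P: "P g0" "\<And>u w. u \<in> U \<Longrightarrow> g0 u w = f u"
    and cont: "\<And>g. P g \<Longrightarrow> continuous_on (U \<times> UNIV) (\<lambda>(u, w). g u w)"
    and der: "\<And>g i. P g \<Longrightarrow> \<exists>g'. P g' \<and> (\<forall>u\<in>U. \<forall>w. has_gateaux (\<lambda>u. g u w) u (w i) (g' u w))"
  shows "smooth_on U f"
proof -
  have fam: "\<exists>g. P g \<and> (\<forall>u\<in>U. \<forall>w. g u w = iter_gateaux f (map w is) u)" for "is" :: "nat list"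
  proof (induction "is")
    case Nil
    with P show ?case by auto
  next
    case (Cons i "is")
    then obtain g where g: "P g" "\<And>u w. u \<in> U \<Longrightarrow> g u w = iter_gateaux f (map w is) u" by blast
    obtain g' where g': "P g'" "\<And>u w. u \<in> U \<Longrightarrow> has_gateaux (\<lambda>u. g u w) u (w i) (g' u w)"
      using der[OF g(1)] by blast
    have "g' u w = iter_gateaux f (map w (i # is)) u" if "u \<in> U" for u w
    proof -
      have "g' u w = gateaux (\<lambda>u. g u w) u (w i)"
        using gateaux_eqI[OF g'(2)[OF that]] by simp
      also have "\<dots> = gateaux (iter_gateaux f (map w is)) u (w i)"
        by (intro gateaux_cong[OF U that] g)
      finally show ?thesis by simp
    qed
    with g'(1) show ?case by blast
  qed
  show ?thesis
    unfolding smooth_on_def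
  proof (intro conjI allI ballI)
    fix vs and u v :: 'a
    assume u: "u \<in> U"
    \<comment> \<open>Position \<open>0\<close> of \<open>w\<close> holds the additional direction
      \<open>v\<close>; the shift by \<open>Suc\<close> below makes the remaining positions spell
      out \<open>vs\<close>.\<close>
    define w where "w = (\<lambda>i. (v # vs) ! i)"
    have w: "map w (map Suc [0..<length vs]) = vs"
      by (rule nth_equalityI) (simp_all add: w_def)
    obtain g where g: "P g" "\<And>u. u \<in> U \<Longrightarrow> g u w = iter_gateaux f (map w (map Suc [0..<length vs])) u"
      using fam[of "map Suc [0..<length vs]"] by blast
    note g(2)[unfolded w]
    obtain g' where "has_gateaux (\<lambda>u. g u w) u (w 0) (g' u w)"
      using der[OF g(1)] u by blast
    then have "has_gateaux (iter_gateaux f vs) u v (g' u w)"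
      using has_gateaux_cong[OF U u \<open>\<And>u. u \<in> U \<Longrightarrow> g u w = iter_gateaux f vs u\<close>] by (simp add: w_def)
    then show "\<exists>l. ((\<lambda>\<epsilon>. (iter_gateaux f vs (u + \<epsilon> *\<^sub>R v) - iter_gateaux f vs u) /\<^sub>R \<epsilon>) \<longlongrightarrow> l) (at 0)"
      unfolding has_gateaux_def by blast
  next
    fix k
    obtain g where g: "P g" "\<forall>u\<in>U. \<forall>w. g u w = iter_gateaux f (map w [0..<k]) u"
      using fam[of "[0..<k]"] by blast
    show "continuous_on (U \<times> UNIV) (\<lambda>(u, w :: nat \<Rightarrow> 'a). iter_gateaux f (map w [0..<k]) u)"
      using cont[OF g(1)] g(2) by (subst continuous_on_cong) auto
  qed
qed

lemma smooth_on_cong: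
  assumes "open U" "smooth_on U f" "\<And>u. u \<in> U \<Longrightarrow> f u = g u"
  shows "smooth_on U g"
proof (rule smooth_onI_family[OF assms(1), where P = "\<lambda>h. \<exists>is. h = (\<lambda>u w. iter_gateaux f (map w is) u)"
      and ?g0.0 = "\<lambda>u w. f u"])
  show "\<exists>is. (\<lambda>u w. f u) = (\<lambda>u w. iter_gateaux f (map w is) u)" by (intro exI[of _ "[]"]) simp
next
  fix h :: "'a \<Rightarrow> (nat \<Rightarrow> 'a) \<Rightarrow> 'b"
  assume "\<exists>is. h = (\<lambda>u w. iter_gateaux f (map w is) u)"
  then obtain "is" where h: "h = (\<lambda>u w. iter_gateaux f (map w is) u)" by blast
  show "continuous_on (U \<times> UNIV) (\<lambda>(u, w). h u w)"
    using smooth_on_continuous_iter[OF assms(2), of "U \<times> UNIV" fst "is" "\<lambda>i x. snd x i"]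
    by (simp add: h case_prod_unfold continuous_on_fst continuous_on_product_then_coordinatewise continuous_on_snd)
  show "\<exists>g'. (\<exists>is. g' = (\<lambda>u w. iter_gateaux f (map w is) u)) \<and>
    (\<forall>u\<in>U. \<forall>w. has_gateaux (\<lambda>u. h u w) u (w i) (g' u w))" for i
    unfolding h using smooth_on_has_dd[OF assms(2)]
    by (intro exI[of _ "\<lambda>u w. iter_gateaux f (map w (i # is)) u"] conjI exI[of _ "i # is"])
      (simp_all del: iter_gateaux.simps)
qed (use assms in auto)

text \<open>Point and directions are kept as separate arguments, as the coinduction principle
  demands. Such functions are the building blocks of most classes to which it is applied.\<close>

definition smooth_family :: "'e::hausdorff_lcs set \<Rightarrow> ('e \<Rightarrow> (nat \<Rightarrow> 'e) \<Rightarrow> 'b::hausdorff_lcs) \<Rightarrow> bool" where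
  "smooth_family U g \<longleftrightarrow> (\<exists>f is. smooth_on U f \<and> g = (\<lambda>u w. iter_gateaux f (map w is) u))"

lemma smooth_family_self: "smooth_on U f \<Longrightarrow> smooth_family U (\<lambda>u w. f u)"
  unfolding smooth_family_def by (intro exI[of _ f] exI[of _ "[]"]) simp

lemma smooth_family_continuous:
  assumes "smooth_family U g"
  shows "continuous_on (U \<times> UNIV) (\<lambda>x. g (fst x) (snd x))"
proof -
  obtain f "is" where f: "smooth_on U f" "g = (\<lambda>u w. iter_gateaux f (map w is) u)"
    using assms unfolding smooth_family_def by blast
  show ?thesis
    using smooth_on_continuous_iter[OF f(1), of "U \<times> UNIV" fst "is" "\<lambda>i x. snd x i"]
    by (simp add: f(2) continuous_on_fst continuous_on_product_then_coordinatewise continuous_on_snd)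
qed

lemma smooth_family_derivative:
  assumes "smooth_family U g"
  shows "\<exists>g'. smooth_family U g' \<and> (\<forall>u\<in>U. \<forall>w. has_gateaux (\<lambda>u. g u w) u (w i) (g' u w))"
proof -
  obtain f "is" where f: "smooth_on U f" "g = (\<lambda>u w. iter_gateaux f (map w is) u)"
    using assms unfolding smooth_family_def by blast
  show ?thesis
    unfolding smooth_family_def f(2) using smooth_on_has_dd[OF f(1)] f(1)
    by (intro exI[of _ "\<lambda>u w. iter_gateaux f (map w (i # is)) u"] conjI exI[of _ f] exI[of _ "i # is"])
      (simp_all del: iter_gateaux.simps)
qed

text \<open>
  The summands that occur in the iterated derivatives of \<open>f \<circ> p\<close> (Faa di Bruno's formula).
\<close>

inductive composite_family for U f p where
  iter: "(\<And>a. a \<in> set as \<Longrightarrow> smooth_family U a) \<Longrightarrow>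
    composite_family U f p (\<lambda>u w. iter_gateaux f (map (\<lambda>a. a u w) as) (p u))"
| add: "composite_family U f p g \<Longrightarrow> composite_family U f p h \<Longrightarrow>
    composite_family U f p (\<lambda>u w. g u w + h u w)"

lemma composite_family_add_sum:
  fixes n :: nat
  assumes "composite_family U f p g" "\<And>k. k < n \<Longrightarrow> composite_family U f p (h k)"
  shows "composite_family U f p (\<lambda>u w. g u w + (\<Sum>k<n. h k u w))"
  using assms(2)
proof (induction n)
  case (Suc n)
  then have "composite_family U f p (\<lambda>u w. (g u w + (\<Sum>k<n. h k u w)) + h n u w)"
    using composite_family.add[OF Suc.IH] by simp
  then show ?case by (simp add: add.assoc)
qed (use assms(1) in simp)

text \<open>Carrying the moving directions \<open>as\<close> along yields two results at once: the
  empty list gives composition, and \<open>[a]\<close> gives the derivative of \<open>f\<close> at a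
  moving point in a moving direction.\<close>

lemma smooth_on_iter_compose:
  fixes f :: "'a::hausdorff_lcs \<Rightarrow> 'b::hausdorff_lcs" and p :: "'e::hausdorff_lcs \<Rightarrow> 'a"
  assumes f: "smooth_on V f" "open V" and p: "smooth_on U p" "open U" "p ` U \<subseteq> V"
    and as: "\<And>a. a \<in> set as \<Longrightarrow> smooth_on U a"
  shows "smooth_on U (\<lambda>u. iter_gateaux f (map (\<lambda>a. a u) as) (p u))"
proof (rule smooth_onI_family[OF p(2), where P = "composite_family U f p"])
  let ?as = "map (\<lambda>a u w. a u) as"
  show "composite_family U f p (\<lambda>u w. iter_gateaux f (map (\<lambda>a. a u w) ?as) (p u))"
    using as by (intro composite_family.iter) (auto intro: smooth_family_self)
  show "iter_gateaux f (map (\<lambda>a. a u w) ?as) (p u) = iter_gateaux f (map (\<lambda>a. a u) as) (p u)" for u w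
    by (simp add: comp_def)
next
  have cp: "continuous_on (U \<times> (UNIV :: (nat \<Rightarrow> 'e) set)) (\<lambda>x. p (fst x))"
    using smooth_family_continuous[OF smooth_family_self[OF p(1)]] .
  fix g assume "composite_family U f p g"
  then show "continuous_on (U \<times> UNIV) (\<lambda>(u, w). g u w)"
  proof induction
    case (iter as)
    show ?case
      unfolding case_prod_unfold using p(3) iter
      by (intro smooth_on_continuous_iter[OF f(1) cp] smooth_family_continuous) auto
  next
    case (add g h)
    then show ?case by (simp add: case_prod_unfold continuous_on_add)
  qed
next
  fix g i assume "composite_family U f p g"
  then show "\<exists>g'. composite_family U f p g' \<and> (\<forall>u\<in>U. \<forall>w. has_gateaux (\<lambda>u. g u w) u (w i) (g' u w))"
  proof induction
    case (iter as)
    have "\<exists>D. \<forall>a\<in>set as. smooth_family U (D a) \<and> (\<forall>u\<in>U. \<forall>w. has_gateaux (\<lambda>u. a u w) u (w i) (D a u w))"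
      by (intro bchoice ballI smooth_family_derivative iter)
    then obtain D where D: "\<And>a. a \<in> set as \<Longrightarrow> smooth_family U (D a)"
      "\<And>a u w. a \<in> set as \<Longrightarrow> u \<in> U \<Longrightarrow> has_gateaux (\<lambda>u. a u w) u (w i) (D a u w)" by blast
    obtain p' where p': "smooth_family U p'" "\<And>u w. u \<in> U \<Longrightarrow> has_gateaux p u (w i) (p' u w)"
      using smooth_family_derivative[OF smooth_family_self[OF p(1)]] by blast
    \<comment> \<open>The derivative of a summand is a sum of such summands: one with the additional
      direction \<open>p'\<close>, and one for each direction replaced by its derivative.\<close>
    let ?g = "\<lambda>u w. iter_gateaux f (map (\<lambda>a. a u w) (p' # as)) (p u)
      + (\<Sum>k<length as. iter_gateaux f (map (\<lambda>a. a u w) (as[k := D (as ! k)])) (p u))"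
    have "composite_family U f p ?g"
    proof (intro composite_family_add_sum composite_family.iter)
      show "smooth_family U a" if "a \<in> set (p' # as)" for a
        using that iter p'(1) by auto
      show "smooth_family U a" if "k < length as" "a \<in> set (as[k := D (as ! k)])" for k a
        using that iter D(1) set_update_subset_insert[of as k "D (as ! k)"] by auto
    qed
    moreover have "has_gateaux (\<lambda>u. iter_gateaux f (map (\<lambda>a. a u w) as) (p u)) u (w i) (?g u w)"
      if "u \<in> U" for u w
    proof -
      have "p u \<in> V" using p(3) that by blast
      from has_gateaux_iter_compose[OF f this p'(2)[OF that], where us = "[]" and js = as
          and b = "\<lambda>a u. a u w" and b' = "\<lambda>a. D a u w"]
      show ?thesis
        using D(2) that by (simp add: map_update del: iter_gateaux.simps)
    qed
    ultimately show ?case by blast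
  next
    case (add g h)
    obtain g' h' where g': "composite_family U f p g'" "\<And>u w. u \<in> U \<Longrightarrow> has_gateaux (\<lambda>u. g u w) u (w i) (g' u w)"
      and h': "composite_family U f p h'" "\<And>u w. u \<in> U \<Longrightarrow> has_gateaux (\<lambda>u. h u w) u (w i) (h' u w)"
      using add.IH by blast
    show ?case
      by (intro exI[of _ "\<lambda>u w. g' u w + h' u w"] conjI ballI allI
          composite_family.add[OF g'(1) h'(1)] has_gateaux_add[OF g'(2) h'(2)])
  qed
qed

lemma smooth_on_compose:
  assumes "smooth_on V f" "open V" "smooth_on U p" "open U" "p ` U \<subseteq> V"
  shows "smooth_on U (\<lambda>u. f (p u))"
  using smooth_on_iter_compose[OF assms, of "[]"] by simp

lemma smooth_on_gateaux_compose:
  assumes "smooth_on V f" "open V" "smooth_on U p" "open U" "p ` U \<subseteq> V" "smooth_on U a"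
  shows "smooth_on U (\<lambda>u. gateaux f (p u) (a u))"
  using smooth_on_iter_compose[OF assms(1-5), of "[a]"] assms(6) by simp

lemma smooth_on_imp_continuous_on:
  assumes "smooth_on U f"
  shows "continuous_on U f"
proof -
  have "continuous_on U (\<lambda>u. (u, \<lambda>_::nat. 0 :: 'a))"
    by (intro continuous_intros)
  then have "continuous_on U (\<lambda>u. (\<lambda>x. f (fst x)) (u, \<lambda>_::nat. 0 :: 'a))"
    by (rule continuous_on_compose2[OF smooth_family_continuous[OF smooth_family_self[OF assms]]]) auto
  then show ?thesis by simp
qed

section \<open>Constructions of smooth maps: linear maps, pairs, vectors and products\<close>

lemma smooth_on_const: "open U \<Longrightarrow> smooth_on U (\<lambda>_. c)"
  by (rule smooth_onI_family[where P = "\<lambda>h. \<exists>c. h = (\<lambda>_ _. c)" and ?g0.0 = "\<lambda>_ _. c"])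
    (auto intro!: has_gateaux_const)

lemma has_gateaux_ident: "has_gateaux (\<lambda>u. u) u v v"
proof -
  have "eventually (\<lambda>h. v = (u + h *\<^sub>R v - u) /\<^sub>R h) (at 0)"
    using eventually_neq_at_within[of 0] by eventually_elim simp
  then show ?thesis
    unfolding has_gateaux_def by (rule Lim_transform_eventually[OF tendsto_const])
qed

lemma smooth_on_ident:
  fixes U :: "'a::hausdorff_lcs set"
  assumes "open U"
  shows "smooth_on U (\<lambda>u. u)"
proof (rule smooth_onI_family[OF assms, where ?g0.0 = "\<lambda>u w. u"
      and P = "\<lambda>h. h = (\<lambda>u w. u) \<or> (\<exists>i. h = (\<lambda>u w. w i)) \<or> h = (\<lambda>u w. 0)"])
  fix h :: "'a \<Rightarrow> (nat \<Rightarrow> 'a) \<Rightarrow> 'a"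
  assume h: "h = (\<lambda>u w. u) \<or> (\<exists>i. h = (\<lambda>u w. w i)) \<or> h = (\<lambda>u w. 0)"
  have "continuous_on (U \<times> UNIV) (\<lambda>x. snd x i)" for i :: nat
    by (rule continuous_on_product_then_coordinatewise[OF continuous_on_snd[OF continuous_on_id]])
  then show "continuous_on (U \<times> UNIV) (\<lambda>(u, w). h u w)"
    using h by (elim disjE exE) (simp_all add: case_prod_unfold continuous_on_fst)
  show "\<exists>g'. (g' = (\<lambda>u w. u) \<or> (\<exists>i. g' = (\<lambda>u w. w i)) \<or> g' = (\<lambda>u w. 0)) \<and>
      (\<forall>u\<in>U. \<forall>w. has_gateaux (\<lambda>u. h u w) u (w i) (g' u w))" for i
    using h
  proof (elim disjE exE)
    assume "h = (\<lambda>u w. u)"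
    then show ?thesis by (intro exI[of _ "\<lambda>u w. w i"]) (auto simp: has_gateaux_ident)
  qed (intro exI[of _ "\<lambda>u w. 0"]; simp add: has_gateaux_const)+
qed simp_all

lemma has_gateaux_linear:
  assumes "linear T" "continuous_on UNIV T" "has_gateaux f u v l"
  shows "has_gateaux (\<lambda>x. T (f x)) u v (T l)"
proof -
  interpret linear T by fact
  have "((\<lambda>h. T ((f (u + h *\<^sub>R v) - f u) /\<^sub>R h)) \<longlongrightarrow> T l) (at 0)"
    using continuous_on_tendsto_compose[OF assms(2) assms(3)[unfolded has_gateaux_def]] by simp
  then show ?thesis unfolding has_gateaux_def by (simp add: scale diff)
qed

text \<open>A continuous linear map commutes with differentiation. Projections, coordinates and
  addition reduce to this case.\<close>

lemma smooth_on_linear: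
  assumes T: "linear T" "continuous_on UNIV T" and f: "smooth_on U f" "open U"
  shows "smooth_on U (\<lambda>u. T (f u))"
proof (rule smooth_onI_family[OF f(2), where ?g0.0 = "\<lambda>u w. T (f u)"
      and P = "\<lambda>h. \<exists>a. smooth_family U a \<and> h = (\<lambda>u w. T (a u w))"])
  show "\<exists>a. smooth_family U a \<and> (\<lambda>u w. T (f u)) = (\<lambda>u w. T (a u w))"
    using smooth_family_self[OF f(1)] by blast
next
  fix h assume "\<exists>a. smooth_family U a \<and> h = (\<lambda>u w. T (a u w))"
  then obtain a where a: "smooth_family U a" "h = (\<lambda>u w. T (a u w))" by blast
  show "continuous_on (U \<times> UNIV) (\<lambda>(u, w). h u w)"
    unfolding a(2) case_prod_unfold
    by (rule continuous_on_compose2[OF T(2) smooth_family_continuous[OF a(1)]]) simp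
  fix i
  obtain a' where a': "smooth_family U a'" "\<And>u w. u \<in> U \<Longrightarrow> has_gateaux (\<lambda>u. a u w) u (w i) (a' u w)"
    using smooth_family_derivative[OF a(1)] by blast
  show "\<exists>g'. (\<exists>a. smooth_family U a \<and> g' = (\<lambda>u w. T (a u w))) \<and>
      (\<forall>u\<in>U. \<forall>w. has_gateaux (\<lambda>u. h u w) u (w i) (g' u w))"
    unfolding a(2)
    by (intro exI[of _ "\<lambda>u w. T (a' u w)"] conjI exI[of _ a'] a'(1) refl ballI allI
        has_gateaux_linear[OF T] a'(2))
qed simp

lemma has_gateaux_Pair:
  assumes "has_gateaux f u v a" "has_gateaux g u v b"
  shows "has_gateaux (\<lambda>x. (f x, g x)) u v (a, b)"
  using tendsto_Pair[OF assms[unfolded has_gateaux_def]] unfolding has_gateaux_def by simp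

lemma smooth_on_Pair:
  assumes f: "smooth_on U f" "smooth_on U g" "open U"
  shows "smooth_on U (\<lambda>u. (f u, g u))"
proof (rule smooth_onI_family[OF f(3), where ?g0.0 = "\<lambda>u w. (f u, g u)"
      and P = "\<lambda>h. \<exists>a b. smooth_family U a \<and> smooth_family U b \<and> h = (\<lambda>u w. (a u w, b u w))"])
  show "\<exists>a b. smooth_family U a \<and> smooth_family U b \<and> (\<lambda>u w. (f u, g u)) = (\<lambda>u w. (a u w, b u w))"
    using smooth_family_self[OF f(1)] smooth_family_self[OF f(2)] by blast
next
  fix h assume "\<exists>a b. smooth_family U a \<and> smooth_family U b \<and> h = (\<lambda>u w. (a u w, b u w))"
  then obtain a b where ab: "smooth_family U a" "smooth_family U b" "h = (\<lambda>u w. (a u w, b u w))" by blast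
  show "continuous_on (U \<times> UNIV) (\<lambda>(u, w). h u w)"
    unfolding ab(3) case_prod_unfold
    by (intro continuous_on_Pair smooth_family_continuous ab)
  fix i
  obtain a' where a': "smooth_family U a'" "\<And>u w. u \<in> U \<Longrightarrow> has_gateaux (\<lambda>u. a u w) u (w i) (a' u w)"
    using smooth_family_derivative[OF ab(1)] by blast
  obtain b' where b': "smooth_family U b'" "\<And>u w. u \<in> U \<Longrightarrow> has_gateaux (\<lambda>u. b u w) u (w i) (b' u w)"
    using smooth_family_derivative[OF ab(2)] by blast
  show "\<exists>g'. (\<exists>a b. smooth_family U a \<and> smooth_family U b \<and> g' = (\<lambda>u w. (a u w, b u w))) \<and>
      (\<forall>u\<in>U. \<forall>w. has_gateaux (\<lambda>u. h u w) u (w i) (g' u w))"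
    unfolding ab(3)
    by (intro exI[of _ "\<lambda>u w. (a' u w, b' u w)"] conjI exI[of _ a'] exI[of _ b'] a'(1) b'(1) refl
        ballI allI has_gateaux_Pair a'(2) b'(2))
qed simp

lemma has_gateaux_vec_lambda:
  assumes "\<And>i. has_gateaux (\<lambda>x. f x i) u v (l i)"
  shows "has_gateaux (\<lambda>x. \<chi> i. f x i) u v (\<chi> i. l i)"
  using assms unfolding has_gateaux_def by (intro vec_tendstoI) simp

lemma smooth_on_vec_lambda:
  fixes f :: "'n::finite \<Rightarrow> 'e::hausdorff_lcs \<Rightarrow> 'b::hausdorff_lcs"
  assumes f: "\<And>i. smooth_on U (f i)" "open U"
  shows "smooth_on U (\<lambda>u. \<chi> i. f i u)"
proof (rule smooth_onI_family[OF f(2), where ?g0.0 = "\<lambda>u w. \<chi> i. f i u"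
      and P = "\<lambda>h. \<exists>a. (\<forall>i. smooth_family U (a i)) \<and> h = (\<lambda>u w. \<chi> i. a i u w)"])
  show "\<exists>a. (\<forall>i. smooth_family U (a i)) \<and> (\<lambda>u w. \<chi> i. f i u) = (\<lambda>u w. \<chi> i. a i u w)"
    using smooth_family_self[OF f(1)] by (intro exI[of _ "\<lambda>i u w. f i u"]) simp
next
  fix h :: "'e \<Rightarrow> (nat \<Rightarrow> 'e) \<Rightarrow> 'b ^ 'n"
  assume "\<exists>a. (\<forall>i. smooth_family U (a i)) \<and> h = (\<lambda>u w. \<chi> i. a i u w)"
  then obtain a where a: "\<And>i. smooth_family U (a i)" "h = (\<lambda>u w. \<chi> i. a i u w)" by blast
  show "continuous_on (U \<times> UNIV) (\<lambda>(u, w). h u w)"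
    unfolding a(2) case_prod_unfold
    by (intro continuous_on_vec_lambda smooth_family_continuous a)
  fix k
  have "\<forall>i. \<exists>a'. smooth_family U a' \<and> (\<forall>u\<in>U. \<forall>w. has_gateaux (\<lambda>u. a i u w) u (w k) (a' u w))"
    using smooth_family_derivative[OF a(1)] by blast
  from choice[OF this] obtain a' where a': "\<And>i. smooth_family U (a' i)"
    "\<And>i u w. u \<in> U \<Longrightarrow> has_gateaux (\<lambda>u. a i u w) u (w k) (a' i u w)"
    by blast
  show "\<exists>g'. (\<exists>a. (\<forall>i. smooth_family U (a i)) \<and> g' = (\<lambda>u w. \<chi> i. a i u w)) \<and>
      (\<forall>u\<in>U. \<forall>w. has_gateaux (\<lambda>u. h u w) u (w k) (g' u w))"
    unfolding a(2)
    by (intro exI[of _ "\<lambda>u w. \<chi> i. a' i u w"] conjI exI[of _ a'] allI a'(1) refl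
        ballI has_gateaux_vec_lambda a'(2))
qed simp

lemma has_gateaux_scaleR_fun:
  assumes r: "has_gateaux r u v r'" and g: "has_gateaux g u v g'"
  shows "has_gateaux (\<lambda>x. r x *\<^sub>R g x) u v (r' *\<^sub>R g u + r u *\<^sub>R g')"
proof -
  let ?c = "\<lambda>h. u + h *\<^sub>R v"
  have "((\<lambda>h. ((r (?c h) - r u) /\<^sub>R h) *\<^sub>R g (?c h) + r u *\<^sub>R ((g (?c h) - g u) /\<^sub>R h))
      \<longlongrightarrow> r' *\<^sub>R g u + r u *\<^sub>R g') (at 0)"
    using has_gateaux_tendsto[OF g] r g unfolding has_gateaux_def
    by (intro tendsto_add tendsto_scaleR_lcs tendsto_const)
  moreover have "((r (?c h) - r u) /\<^sub>R h) *\<^sub>R g (?c h) + r u *\<^sub>R ((g (?c h) - g u) /\<^sub>R h)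
      = (r (?c h) *\<^sub>R g (?c h) - r u *\<^sub>R g u) /\<^sub>R h" for h
    by (simp add: algebra_simps)
  ultimately show ?thesis unfolding has_gateaux_def by (simp only:)
qed

text \<open>The Leibniz rule turns a product into a sum of two, so closure under differentiation
  requires sums as well.\<close>

inductive product_family for U where
  scale: "smooth_family U r \<Longrightarrow> smooth_family U a \<Longrightarrow> product_family U (\<lambda>u w. r u w *\<^sub>R a u w)"
| add: "product_family U g \<Longrightarrow> product_family U h \<Longrightarrow> product_family U (\<lambda>u w. g u w + h u w)"

lemma smooth_on_scaleR:
  assumes r: "smooth_on U r" and f: "smooth_on U f" "open U"
  shows "smooth_on U (\<lambda>u. r u *\<^sub>R f u)"
proof (rule smooth_onI_family[OF f(2), where ?g0.0 = "\<lambda>u w. r u *\<^sub>R f u" and P = "product_family U"])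
  show "product_family U (\<lambda>u w. r u *\<^sub>R f u)"
    by (intro product_family.scale smooth_family_self r f)
next
  fix h assume "product_family U h"
  then show "continuous_on (U \<times> UNIV) (\<lambda>(u, w). h u w)"
    unfolding case_prod_unfold
  proof induction
    case (scale r a)
    then show ?case by (intro continuous_on_scaleR_lcs smooth_family_continuous)
  next
    case (add g h)
    from continuous_on_add[OF add.IH] show ?case .
  qed
next
  fix h i assume "product_family U h"
  then show "\<exists>g'. product_family U g' \<and> (\<forall>u\<in>U. \<forall>w. has_gateaux (\<lambda>u. h u w) u (w i) (g' u w))"
  proof induction
    case (scale r a)
    obtain r' where r': "smooth_family U r'" "\<And>u w. u \<in> U \<Longrightarrow> has_gateaux (\<lambda>u. r u w) u (w i) (r' u w)"
      using smooth_family_derivative[OF scale(1)] by blast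
    obtain a' where a': "smooth_family U a'" "\<And>u w. u \<in> U \<Longrightarrow> has_gateaux (\<lambda>u. a u w) u (w i) (a' u w)"
      using smooth_family_derivative[OF scale(2)] by blast
    show ?case
      by (intro exI[of _ "\<lambda>u w. r' u w *\<^sub>R a u w + r u w *\<^sub>R a' u w"] conjI ballI allI
          product_family.intros scale r'(1) a'(1) has_gateaux_scaleR_fun r'(2) a'(2))
  next
    case (add g h)
    obtain g' h' where g': "product_family U g'" "\<And>u w. u \<in> U \<Longrightarrow> has_gateaux (\<lambda>u. g u w) u (w i) (g' u w)"
      and h': "product_family U h'" "\<And>u w. u \<in> U \<Longrightarrow> has_gateaux (\<lambda>u. h u w) u (w i) (h' u w)"
      using add.IH by blast
    show ?case
      by (intro exI[of _ "\<lambda>u w. g' u w + h' u w"] conjI ballI allI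
          product_family.add[OF g'(1) h'(1)] has_gateaux_add[OF g'(2) h'(2)])
  qed
qed simp

lemma smooth_on_fst: "smooth_on U f \<Longrightarrow> open U \<Longrightarrow> smooth_on U (\<lambda>u. fst (f u))"
  by (rule smooth_on_linear[where T = fst]) (auto intro: linearI continuous_intros)

lemma smooth_on_snd: "smooth_on U f \<Longrightarrow> open U \<Longrightarrow> smooth_on U (\<lambda>u. snd (f u))"
  by (rule smooth_on_linear[where T = snd]) (auto intro: linearI continuous_intros)

lemma smooth_on_vec_nth:
  fixes f :: "_ \<Rightarrow> 'b::hausdorff_lcs ^ 'n"
  shows "smooth_on U f \<Longrightarrow> open U \<Longrightarrow> smooth_on U (\<lambda>u. f u $ i)"
  by (rule smooth_on_linear[where T = "\<lambda>x. x $ i"])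
    (auto intro: linearI simp: continuous_on_def tendsto_vec_nth)

lemma smooth_on_add:
  assumes "smooth_on U f" "smooth_on U g" "open U"
  shows "smooth_on U (\<lambda>u. f u + g u)"
  using smooth_on_linear[OF _ _ smooth_on_Pair[OF assms] assms(3), of "\<lambda>x. fst x + snd x"]
  by (simp add: linearI scaleR_add_right continuous_intros)

lemma smooth_on_scaleR_const:
  assumes "smooth_on U f" "open U"
  shows "smooth_on U (\<lambda>u. c *\<^sub>R f u)"
  by (intro smooth_on_scaleR smooth_on_const assms)

lemma smooth_on_diff:
  assumes "smooth_on U f" "smooth_on U g" "open U"
  shows "smooth_on U (\<lambda>u. f u - g u)"
  using smooth_on_add[OF assms(1) smooth_on_scaleR_const[OF assms(2,3), of "-1"] assms(3)] by simp

lemma smooth_on_sum: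
  assumes "\<And>i. i \<in> I \<Longrightarrow> smooth_on U (f i)" "open U"
  shows "smooth_on U (\<lambda>u. \<Sum>i\<in>I. f i u)"
  using assms(1)
  by (induction I rule: infinite_finite_induct) (simp_all add: smooth_on_const smooth_on_add assms(2))

lemma smooth_on_power:
  fixes r :: "'a::hausdorff_lcs \<Rightarrow> real"
  assumes "smooth_on U r" "open U"
  shows "smooth_on U (\<lambda>u. r u ^ k)"
proof (induction k)
  case (Suc k)
  from smooth_on_scaleR[OF assms(1) this assms(2)] show ?case by simp
qed (simp add: smooth_on_const assms(2))

section \<open>Symmetry and linearity of iterated derivatives\<close>

lemma smooth_on_iter_gateaux:
  fixes f :: "'a::hausdorff_lcs \<Rightarrow> 'b::hausdorff_lcs"
  assumes "smooth_on U f" "open U"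
  shows "smooth_on U (iter_gateaux f vs)"
proof -
  have "smooth_on U a" if "a \<in> set (map (\<lambda>v _. v) vs)" for a :: "'a \<Rightarrow> 'a"
    using that smooth_on_const[OF assms(2)] by auto
  from smooth_on_iter_compose[OF assms smooth_on_ident[OF assms(2)] assms(2),
      where as = "map (\<lambda>v _. v) vs", OF _ this]
  show ?thesis by (simp add: comp_def)
qed

lemma gateaux_commute_smooth:
  assumes "smooth_on U f" "open U" "u \<in> U"
  shows "gateaux (\<lambda>x. gateaux f x v) u w = gateaux (\<lambda>x. gateaux f x w) u v"
  using smooth_on_c1_on[OF assms(1), of "[v]"] smooth_on_c1_on[OF assms(1), of "[w]"]
  by (intro gateaux_commute[OF smooth_on_c1_on_self[OF assms(1)] assms(2,3)]) simp_all

text \<open>The head of the list is the outermost derivative, so the last entry is the one taken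
  first.\<close>

lemma iter_gateaux_snoc: "iter_gateaux f (vs @ [v]) = iter_gateaux (\<lambda>x. gateaux f x v) vs"
  by (induction vs) auto

text \<open>Repeated exchange of neighbours carries the outermost derivative to the innermost place;
  orders above two require symmetry in this form only.\<close>

lemma iter_gateaux_rotate:
  assumes f: "smooth_on U f" "open U" and "u \<in> U"
  shows "iter_gateaux f (v # vs) u = iter_gateaux f (vs @ [v]) u"
  using assms(3)
proof (induction vs arbitrary: u)
  case (Cons z vs)
  have "iter_gateaux f (v # z # vs) u = gateaux (iter_gateaux f (v # vs)) u z"
    using gateaux_commute_smooth[OF smooth_on_iter_gateaux[OF f] f(2) Cons.prems] by simp
  also have "\<dots> = gateaux (iter_gateaux f (vs @ [v])) u z"
    by (intro gateaux_cong[OF f(2) Cons.prems] Cons.IH)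
  finally show ?case by simp
qed simp

lemma iter_gateaux_cong:
  fixes f :: "'a::hausdorff_lcs \<Rightarrow> 'b::hausdorff_lcs"
  assumes "open U" "u \<in> U" "\<And>x. x \<in> U \<Longrightarrow> f x = g x"
  shows "iter_gateaux f vs u = iter_gateaux g vs u"
  using assms(2)
proof (induction vs arbitrary: u)
  case (Cons v vs)
  have "gateaux (iter_gateaux f vs) u v = gateaux (iter_gateaux g vs) u v"
    by (intro gateaux_cong[OF assms(1) Cons.prems] Cons.IH)
  then show ?case by simp
qed (use assms(3) in simp)

lemma iter_gateaux_lincomb:
  assumes f: "smooth_on U f" "smooth_on U g" "open U" and "u \<in> U"
  shows "iter_gateaux (\<lambda>x. a *\<^sub>R f x + b *\<^sub>R g x) vs u
    = a *\<^sub>R iter_gateaux f vs u + b *\<^sub>R iter_gateaux g vs u"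
  using assms(4)
proof (induction vs arbitrary: u)
  case (Cons v vs)
  have "iter_gateaux (\<lambda>x. a *\<^sub>R f x + b *\<^sub>R g x) (v # vs) u
      = gateaux (\<lambda>x. a *\<^sub>R iter_gateaux f vs x + b *\<^sub>R iter_gateaux g vs x) u v"
    unfolding iter_gateaux.simps by (intro gateaux_cong[OF f(3) Cons.prems] Cons.IH)
  also have "\<dots> = a *\<^sub>R iter_gateaux f (v # vs) u + b *\<^sub>R iter_gateaux g (v # vs) u"
    using Cons.prems
    by (intro gateaux_eqI has_gateaux_add has_gateaux_scaleR smooth_on_has_dd[OF f(1)] smooth_on_has_dd[OF f(2)])
  finally show ?case .
qed simp

lemma iter_gateaux_const: "iter_gateaux (\<lambda>_. c) vs u = (if vs = [] then c else 0)"
proof (induction vs arbitrary: u)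
  case (Cons v vs)
  have "iter_gateaux (\<lambda>_. c) vs = (\<lambda>_. if vs = [] then c else 0)"
    using Cons.IH by blast
  then show ?case by (simp add: gateaux_eqI[OF has_gateaux_const])
qed simp

lemma iter_gateaux_sum:
  assumes "\<And>i. i \<in> I \<Longrightarrow> smooth_on U (f i)" "open U" "u \<in> U"
  shows "iter_gateaux (\<lambda>x. \<Sum>i\<in>I. f i x) vs u = (\<Sum>i\<in>I. iter_gateaux (f i) vs u)"
  using assms(1)
proof (induction I rule: infinite_finite_induct)
  case (insert i I)
  then show ?case
    using iter_gateaux_lincomb[OF _ smooth_on_sum assms(2,3), of "f i" I f 1 1 vs] assms(2) by simp
qed (simp_all add: iter_gateaux_const)

section \<open>Derivatives along lines and of curves\<close>

lemma gateaux_line: "gateaux (\<lambda>t. f (a + t *\<^sub>R b)) t 1 = gateaux f (a + t *\<^sub>R b) b"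
  for t :: real
  unfolding gateaux_def curve_deriv_def by (simp add: algebra_simps)

lemma curve_deriv_eq_gateaux: "curve_deriv c t = gateaux c t 1"
  unfolding gateaux_def curve_deriv_def by simp

text \<open>With \<open>a = 0\<close> and \<open>b = 1\<close> this covers arbitrary curves, with
  \<open>b = (0, 1)\<close> the restriction of a map on a product to a fixed first argument.\<close>

lemma funpow_curve_deriv_line:
  "(curve_deriv ^^ k) (\<lambda>t. f (a + t *\<^sub>R b)) = (\<lambda>t. iter_gateaux f (replicate k b) (a + t *\<^sub>R b))"
proof (induction k)
  case (Suc k)
  then show ?case
    by (simp add: curve_deriv_eq_gateaux[abs_def] gateaux_line)
qed simp

lemma funpow_curve_deriv: "(curve_deriv ^^ k) c t = iter_gateaux c (replicate k 1) t"
  using fun_cong[OF funpow_curve_deriv_line[of k c 0 1], of t] by simp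

section \<open>The Lie algebra of vector fields\<close>

lemma vector_fieldsD: "X \<in> vector_fields M \<Longrightarrow> smooth_on M X" "X \<in> vector_fields M \<Longrightarrow> u \<notin> M \<Longrightarrow> X u = 0"
  unfolding vector_fields_def by auto

lemma vector_fields_zero: "open M \<Longrightarrow> (\<lambda>_. 0) \<in> vector_fields M"
  unfolding vector_fields_def by (simp add: smooth_on_const)

lemma vector_fields_lincomb:
  assumes "open M" "X \<in> vector_fields M" "Y \<in> vector_fields M"
  shows "(\<lambda>u. a *\<^sub>R X u + b *\<^sub>R Y u) \<in> vector_fields M"
  using assms unfolding vector_fields_def
  by (simp add: smooth_on_add smooth_on_scaleR_const)

lemma commutator_in_vector_fields:
  assumes "open M" "X \<in> vector_fields M" "Y \<in> vector_fields M"
  shows "commutator M X Y \<in> vector_fields M"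
proof -
  have "smooth_on M (\<lambda>u. gateaux X u (Y u) - gateaux Y u (X u))"
    by (intro smooth_on_diff smooth_on_gateaux_compose[where p = "\<lambda>u. u" and V = M]
        smooth_on_ident assms vector_fieldsD) simp_all
  then have "smooth_on M (commutator M X Y)"
    by (rule smooth_on_cong[OF assms(1)]) (simp add: commutator_def)
  then show ?thesis by (simp add: vector_fields_def commutator_def)
qed

lemma gateaux_diff:
  assumes "c1_on U f" "open U" "u \<in> U"
  shows "gateaux f u (v - w) = gateaux f u v - gateaux f u w"
  using gateaux_add[OF assms, of "v - w" w] by simp

lemma has_gateaux_gateaux_field:
  assumes X: "smooth_on M X" and Y: "smooth_on M Y" and M: "open M" "u \<in> M"
  shows "has_gateaux (\<lambda>x. gateaux X x (Y x)) u v (iter_gateaux X [v, Y u] u + gateaux X u (gateaux Y u v))"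
  using has_gateaux_iter_compose[OF X M(1) M(2) has_gateaux_ident, where js = "[Y]" and us = "[]"
      and b = "\<lambda>Y. Y" and b' = "\<lambda>Y. gateaux Y u v"]
    c1_on_has_dd[OF smooth_on_c1_on_self[OF Y] M(2)]
  by simp

lemma gateaux_commutator:
  assumes X: "smooth_on M X" and Y: "smooth_on M Y" and M: "open M" "u \<in> M"
  shows "gateaux (commutator M X Y) u v
    = iter_gateaux X [v, Y u] u + gateaux X u (gateaux Y u v)
      - (iter_gateaux Y [v, X u] u + gateaux Y u (gateaux X u v))"
proof -
  have "gateaux (commutator M X Y) u v = gateaux (\<lambda>x. gateaux X x (Y x) - gateaux Y x (X x)) u v"
    by (rule gateaux_cong[OF M]) (simp add: commutator_def)
  also have "\<dots> = iter_gateaux X [v, Y u] u + gateaux X u (gateaux Y u v)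
      - (iter_gateaux Y [v, X u] u + gateaux Y u (gateaux X u v))"
    by (intro gateaux_eqI has_gateaux_diff has_gateaux_gateaux_field[OF X Y M] has_gateaux_gateaux_field[OF Y X M])
  finally show ?thesis .
qed

text \<open>In this form \<open>commutator M X\<close> is a derivation of the bracket. After
  expansion, terms with two first derivatives match or cancel, and those with a second derivative do
  so by its symmetry.\<close>

lemma commutator_Jacobi:
  assumes M: "open M" and vf: "X \<in> vector_fields M" "Y \<in> vector_fields M" "Z \<in> vector_fields M"
  shows "commutator M X (commutator M Y Z) =
    (\<lambda>u. commutator M (commutator M X Y) Z u + commutator M Y (commutator M X Z) u)"
proof
  fix u
  show "commutator M X (commutator M Y Z) u =
    commutator M (commutator M X Y) Z u + commutator M Y (commutator M X Z) u"
  proof (cases "u \<in> M")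
    case u: True
    note s = vf[THEN vector_fieldsD(1)]
    note c = s[THEN smooth_on_c1_on_self]
    have sym: "iter_gateaux W [v, w] u = iter_gateaux W [w, v] u" if "smooth_on M W"
      for W :: "'a \<Rightarrow> 'a" and v w
      using gateaux_commute_smooth[OF that M u] by simp
    have com: "commutator M V W u = gateaux V u (W u) - gateaux W u (V u)" for V W
      using u by (simp add: commutator_def)
    show ?thesis
      unfolding com[of X] com[of "commutator M X Y"] com[of Y]
      unfolding com gateaux_diff[OF c(1) M u] gateaux_diff[OF c(2) M u] gateaux_diff[OF c(3) M u]
        gateaux_commutator[OF s(1,2) M u] gateaux_commutator[OF s(1,3) M u] gateaux_commutator[OF s(2,3) M u]
      using sym[OF s(1), of "Y u" "Z u"] sym[OF s(2), of "X u" "Z u"] sym[OF s(3), of "X u" "Y u"]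
      by (simp del: iter_gateaux.simps)
  qed (simp add: commutator_def)
qed

lemma commutator_lincomb_right:
  assumes M: "open M" and vf: "K \<in> vector_fields M" "X \<in> vector_fields M" "Y \<in> vector_fields M"
  shows "commutator M K (\<lambda>u. a *\<^sub>R X u + b *\<^sub>R Y u) =
    (\<lambda>u. a *\<^sub>R commutator M K X u + b *\<^sub>R commutator M K Y u)"
proof
  fix u
  show "commutator M K (\<lambda>u. a *\<^sub>R X u + b *\<^sub>R Y u) u
      = a *\<^sub>R commutator M K X u + b *\<^sub>R commutator M K Y u"
  proof (cases "u \<in> M")
    case u: True
    note c = vf[THEN vector_fieldsD(1), THEN smooth_on_c1_on_self]
    have "gateaux K u (a *\<^sub>R X u + b *\<^sub>R Y u) = a *\<^sub>R gateaux K u (X u) + b *\<^sub>R gateaux K u (Y u)"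
      by (simp add: gateaux_add[OF c(1) M u] gateaux_scaleR[OF c(1) M u])
    moreover have "gateaux (\<lambda>u. a *\<^sub>R X u + b *\<^sub>R Y u) u (K u)
        = a *\<^sub>R gateaux X u (K u) + b *\<^sub>R gateaux Y u (K u)"
      by (intro gateaux_eqI has_gateaux_add has_gateaux_scaleR c1_on_has_dd[OF c(2) u] c1_on_has_dd[OF c(3) u])
    ultimately show ?thesis using u by (simp add: commutator_def algebra_simps)
  qed (simp add: commutator_def)
qed

lemma gateaux_zero_direction: "gateaux f u 0 = 0"
  by (rule gateaux_eqI) (simp add: has_gateaux_def)

lemma commutator_zero: "commutator M X (\<lambda>_. 0) = (\<lambda>_. 0)" "commutator M (\<lambda>_. 0) X = (\<lambda>_. 0)"
  by (auto simp: commutator_def gateaux_zero_direction gateaux_eqI[OF has_gateaux_const])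

text \<open>The kernel of the derivation \<open>commutator M K\<close> is closed under
  brackets.\<close>

lemma vf_subalgebra_symmetry_algebra:
  assumes M: "open M" and K: "K \<in> vector_fields M"
  shows "vf_subalgebra M (symmetry_algebra M K)"
  unfolding vf_subalgebra_def
proof (intro conjI ballI allI)
  show "symmetry_algebra M K \<subseteq> vector_fields M" by (auto simp: symmetry_algebra_def)
  show "(\<lambda>_. 0) \<in> symmetry_algebra M K"
    by (simp add: symmetry_algebra_def vector_fields_zero[OF M] commutator_zero)
  fix X Y assume "X \<in> symmetry_algebra M K" "Y \<in> symmetry_algebra M K"
  then have X: "X \<in> vector_fields M" "commutator M K X = (\<lambda>_. 0)"
    and Y: "Y \<in> vector_fields M" "commutator M K Y = (\<lambda>_. 0)"
    by (auto simp: symmetry_algebra_def)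
  show "(\<lambda>u. a *\<^sub>R X u + b *\<^sub>R Y u) \<in> symmetry_algebra M K" for a b
    unfolding symmetry_algebra_def
    using vector_fields_lincomb[OF M X(1) Y(1)] commutator_lincomb_right[OF M K X(1) Y(1)] X(2) Y(2)
    by simp
  show "commutator M X Y \<in> symmetry_algebra M K"
    unfolding symmetry_algebra_def
    using commutator_in_vector_fields[OF M X(1) Y(1)] commutator_Jacobi[OF M K X(1) Y(1)] X(2) Y(2)
    by (simp add: commutator_zero)
qed

section \<open>Jets of curves\<close>

lemma has_gateaux_power:
  fixes v :: "'a::hausdorff_lcs"
  shows "has_gateaux (\<lambda>t::real. t ^ m *\<^sub>R v) t 1 ((real m * t ^ (m - 1)) *\<^sub>R v)"
proof -
  have "((\<lambda>t::real. t ^ m) has_field_derivative real m * t ^ (m - 1)) (at t)"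
    by (auto intro!: derivative_eq_intros)
  then have "has_gateaux (\<lambda>t::real. t ^ m) t 1 (real m * t ^ (m - 1))"
    unfolding has_gateaux_def DERIV_def by (simp add: divide_inverse mult.commute)
  from has_gateaux_scaleR_fun[OF this has_gateaux_const[of v]] show ?thesis by simp
qed

text \<open>Subtraction is truncated: for \<open>k > m\<close> the factor with \<open>j = m\<close>
  vanishes, so the formula holds although \<open>t ^ (m - k)\<close> is then
  \<open>1\<close>.\<close>

lemma iter_gateaux_power:
  fixes v :: "'a::hausdorff_lcs"
  shows "iter_gateaux (\<lambda>t::real. t ^ m *\<^sub>R v) (replicate k 1) t
    = ((\<Prod>j<k. real (m - j)) * t ^ (m - k)) *\<^sub>R v"
proof (induction k arbitrary: t)
  case (Suc k)
  have "iter_gateaux (\<lambda>t::real. t ^ m *\<^sub>R v) (replicate k 1)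
      = (\<lambda>t. (\<Prod>j<k. real (m - j)) *\<^sub>R (t ^ (m - k) *\<^sub>R v))"
    using Suc.IH by auto
  then show ?case
    using gateaux_eqI[OF has_gateaux_scaleR[OF has_gateaux_power[of "m - k" v t], of "\<Prod>j<k. real (m - j)"]]
    by (simp add: mult_ac)
qed simp

lemma iter_gateaux_power_0:
  fixes v :: "'a::hausdorff_lcs"
  shows "iter_gateaux (\<lambda>t::real. t ^ m *\<^sub>R v) (replicate k 1) 0 = (if m = k then fact k *\<^sub>R v else 0)"
proof -
  consider "m = k" | "m < k" | "m > k" by linarith
  then show ?thesis
  proof cases
    case 1
    then show ?thesis
      unfolding iter_gateaux_power by (simp add: fact_prod_rev atLeast0LessThan)
  next
    case 2
    then have "(\<Prod>j<k. real (m - j)) = 0"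
      by (intro prod_zero) auto
    with 2 show ?thesis unfolding iter_gateaux_power by simp
  next
    case 3
    then show ?thesis unfolding iter_gateaux_power by simp
  qed
qed

lemma gateaux_slice:
  "gateaux (\<lambda>\<epsilon>::real. G (\<epsilon>, y)) \<epsilon> 1 = gateaux G (\<epsilon>, y) (1, 0)"
  unfolding gateaux_def curve_deriv_def by simp

text \<open>This permits replacing a curve by its Taylor polynomial in a linear slot.
  Differentiating once gives the partial derivative of \<open>G\<close> in \<epsilon> at
  \<open>a\<close>, plus \<open>G\<close> at \<open>a'\<close>. Both have the original form with the
  order lowered by one, and the derivatives of \<open>a'\<close> still vanish that far; hence
  \<open>G\<close> and \<open>a\<close> vary in the induction.\<close>

lemma iter_gateaux_vanishing_jet:
  fixes G :: "real \<times> 'a::hausdorff_lcs \<Rightarrow> 'b::hausdorff_lcs"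
  assumes J: "open J" "0 \<in> J" and "smooth_on (J \<times> UNIV) G" and "\<And>\<epsilon>. \<epsilon> \<in> J \<Longrightarrow> linear (\<lambda>y. G (\<epsilon>, y))"
    and "smooth_on J a" and "\<And>j. j \<le> i \<Longrightarrow> iter_gateaux a (replicate j 1) 0 = 0"
  shows "iter_gateaux (\<lambda>\<epsilon>. G (\<epsilon>, a \<epsilon>)) (replicate i 1) 0 = 0"
  using assms(3-)
proof (induction i arbitrary: G a)
  case 0
  then show ?case using linear_0[OF 0(2)[OF J(2)]] 0(4)[of 0] by simp
next
  case (Suc i)
  let ?V = "J \<times> (UNIV :: 'a set)"
  have V: "open ?V" using J by (simp add: open_Times)
  note G = Suc.prems(1) and lin = Suc.prems(2) and a = Suc.prems(3)
  note cG = smooth_on_c1_on_self[OF G] and ca = smooth_on_c1_on_self[OF a]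
  define G' where "G' = (\<lambda>z. gateaux G z (1, 0))"
  define a' where "a' = (\<lambda>\<epsilon>. gateaux a \<epsilon> 1)"
  have G': "smooth_on ?V G'"
    unfolding G'_def using smooth_on_iter_gateaux[OF G V, of "[(1, 0)]"] by simp
  have a': "smooth_on J a'"
    unfolding a'_def using smooth_on_iter_gateaux[OF a J(1), of "[1]"] by simp
  have slice: "has_gateaux (\<lambda>\<epsilon>. G (\<epsilon>, y)) \<epsilon> 1 (G' (\<epsilon>, y))" if "\<epsilon> \<in> J" for \<epsilon> y
    using c1_on_has_dd[OF cG, of "(\<epsilon>, y)" "(1, 0)"] that by (simp add: has_gateaux_def G'_def)
  \<comment> \<open>Differentiation in \<epsilon> keeps linearity in \<open>y\<close>, as the
    identities hold throughout the open set \<open>J\<close>.\<close>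
  have lin': "linear (\<lambda>y. G' (\<epsilon>, y))" if e: "\<epsilon> \<in> J" for \<epsilon>
  proof (rule linearI)
    fix y z
    have "G' (\<epsilon>, y + z) = gateaux (\<lambda>\<epsilon>. G (\<epsilon>, y + z)) \<epsilon> 1"
      by (simp add: gateaux_slice G'_def)
    also have "\<dots> = gateaux (\<lambda>\<epsilon>. G (\<epsilon>, y) + G (\<epsilon>, z)) \<epsilon> 1"
      by (intro gateaux_cong[OF J(1) e] linear_add[OF lin])
    also have "\<dots> = G' (\<epsilon>, y) + G' (\<epsilon>, z)"
      by (intro gateaux_eqI has_gateaux_add slice e)
    finally show "G' (\<epsilon>, y + z) = G' (\<epsilon>, y) + G' (\<epsilon>, z)" .
  next
    fix r y
    have "G' (\<epsilon>, r *\<^sub>R y) = gateaux (\<lambda>\<epsilon>. G (\<epsilon>, r *\<^sub>R y)) \<epsilon> 1"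
      by (simp add: gateaux_slice G'_def)
    also have "\<dots> = gateaux (\<lambda>\<epsilon>. r *\<^sub>R G (\<epsilon>, y)) \<epsilon> 1"
      by (intro gateaux_cong[OF J(1) e] linear_scale[OF lin])
    also have "\<dots> = r *\<^sub>R G' (\<epsilon>, y)"
      by (intro gateaux_eqI has_gateaux_scaleR slice e)
    finally show "G' (\<epsilon>, r *\<^sub>R y) = r *\<^sub>R G' (\<epsilon>, y)" .
  qed
  \<comment> \<open>The factors \<open>1\<close> give the right-hand side the shape of
    \<open>iter_gateaux_lincomb\<close>.\<close>
  have der: "gateaux (\<lambda>\<epsilon>. G (\<epsilon>, a \<epsilon>)) \<epsilon> 1 = 1 *\<^sub>R G' (\<epsilon>, a \<epsilon>) + 1 *\<^sub>R G (\<epsilon>, a' \<epsilon>)" if e: "\<epsilon> \<in> J" for \<epsilon>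
  proof -
    have z: "(\<epsilon>, a \<epsilon>) \<in> ?V" using e by simp
    have "has_gateaux (\<lambda>\<epsilon>. (\<epsilon>, a \<epsilon>)) \<epsilon> 1 (1, a' \<epsilon>)"
      unfolding a'_def by (intro has_gateaux_Pair has_gateaux_ident c1_on_has_dd[OF ca e])
    from has_gateaux_iter_compose[OF G V z this, where js = "[]" and us = "[]"]
    have "gateaux (\<lambda>\<epsilon>. G (\<epsilon>, a \<epsilon>)) \<epsilon> 1 = gateaux G (\<epsilon>, a \<epsilon>) (1, a' \<epsilon>)"
      by (intro gateaux_eqI) simp
    also have "\<dots> = G' (\<epsilon>, a \<epsilon>) + gateaux G (\<epsilon>, a \<epsilon>) (0, a' \<epsilon>)"
      using gateaux_add[OF cG V z, of "(1, 0)" "(0, a' \<epsilon>)"] by (simp add: G'_def)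
    also have "gateaux G (\<epsilon>, a \<epsilon>) (0, a' \<epsilon>) = G (\<epsilon>, a' \<epsilon>)"
    proof (rule gateaux_eqI)
      \<comment> \<open>By linearity in the second argument the difference quotient is constant in
        \<open>h\<close>.\<close>
      have "eventually (\<lambda>h. G (\<epsilon>, a' \<epsilon>)
          = (G ((\<epsilon>, a \<epsilon>) + h *\<^sub>R (0, a' \<epsilon>)) - G (\<epsilon>, a \<epsilon>)) /\<^sub>R h) (at 0)"
        using eventually_neq_at_within[of 0]
        by eventually_elim (simp add: linear_add[OF lin[OF e]] linear_scale[OF lin[OF e]])
      then show "has_gateaux G (\<epsilon>, a \<epsilon>) (0, a' \<epsilon>) (G (\<epsilon>, a' \<epsilon>))"
        unfolding has_gateaux_def by (rule Lim_transform_eventually[OF tendsto_const])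
    qed
    finally show ?thesis by simp
  qed
  have sm: "smooth_on J (\<lambda>\<epsilon>. H (\<epsilon>, b \<epsilon>))" if "smooth_on ?V H" "smooth_on J b"
    for H :: "real \<times> 'a \<Rightarrow> 'b" and b
    using that by (intro smooth_on_compose[OF that(1) V] smooth_on_Pair smooth_on_ident J) auto
  have "iter_gateaux (\<lambda>\<epsilon>. G (\<epsilon>, a \<epsilon>)) (replicate (Suc i) 1) 0
      = iter_gateaux (\<lambda>\<epsilon>. gateaux (\<lambda>\<epsilon>. G (\<epsilon>, a \<epsilon>)) \<epsilon> 1) (replicate i 1) 0"
    unfolding replicate_Suc replicate_append_same[symmetric] iter_gateaux_snoc ..
  also have "\<dots> = iter_gateaux (\<lambda>\<epsilon>. 1 *\<^sub>R G' (\<epsilon>, a \<epsilon>) + 1 *\<^sub>R G (\<epsilon>, a' \<epsilon>)) (replicate i 1) 0"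
    by (intro iter_gateaux_cong[OF J] der)
  also have "\<dots> = 1 *\<^sub>R iter_gateaux (\<lambda>\<epsilon>. G' (\<epsilon>, a \<epsilon>)) (replicate i 1) 0
      + 1 *\<^sub>R iter_gateaux (\<lambda>\<epsilon>. G (\<epsilon>, a' \<epsilon>)) (replicate i 1) 0"
    by (intro iter_gateaux_lincomb[OF sm[OF G' a] sm[OF G a'] J])
  also have "iter_gateaux (\<lambda>\<epsilon>. G' (\<epsilon>, a \<epsilon>)) (replicate i 1) 0 = 0"
    by (intro Suc.IH G' lin' a Suc.prems(4)) simp_all
  also have "iter_gateaux (\<lambda>\<epsilon>. G (\<epsilon>, a' \<epsilon>)) (replicate i 1) 0 = 0"
  proof (intro Suc.IH G lin a')
    fix j assume "j \<le> i"
    have "iter_gateaux a' (replicate j 1) 0 = iter_gateaux a (replicate (Suc j) 1) 0"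
      unfolding replicate_Suc replicate_append_same[symmetric] iter_gateaux_snoc a'_def ..
    then show "iter_gateaux a' (replicate j 1) 0 = 0"
      using Suc.prems(4)[of "Suc j"] \<open>j \<le> i\<close> by simp
  qed
  finally show ?case by simp
qed

section \<open>Perturbation vector fields\<close>

lemma inj_idx: "inj (idx :: 'n::{finite,linorder} \<Rightarrow> nat)"
  using bij_betw_idx by (rule bij_betw_imp_inj_on)

lemma idx_eq_0_iff: "idx i = 0 \<longleftrightarrow> i = (Min UNIV :: 'n::{finite,linorder})"
  using inj_idx idx_Min by (metis injD)

lemma u_hat_0: "u_hat \<eta> 0 = \<eta> $ Min UNIV"
proof -
  have "u_hat \<eta> 0 = (\<Sum>i\<in>UNIV. if i = Min UNIV then \<eta> $ i else 0)"
    unfolding u_hat_def by (intro sum.cong) (auto simp: power_0_left idx_eq_0_iff)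
  then show ?thesis by simp
qed

lemma u_hat_add_scaleR: "u_hat (\<eta> + h *\<^sub>R \<xi>) \<epsilon> = u_hat \<eta> \<epsilon> + h *\<^sub>R u_hat \<xi> \<epsilon>"
  unfolding u_hat_def
  by (simp add: scaleR_add_right sum.distrib scaleR_sum_right mult.commute)

lemma smooth_on_u_hat:
  assumes "smooth_on U g" "smooth_on U e" "open U"
  shows "smooth_on U (\<lambda>z. u_hat (g z) (e z))"
  unfolding u_hat_def
  by (intro smooth_on_sum smooth_on_scaleR smooth_on_power smooth_on_vec_nth assms)

lemma open_M_hat: "open M \<Longrightarrow> open (M_hat M)"
  using open_vimage_vec_nth[of M "Min UNIV"] by (simp add: M_hat_def vimage_def)

text \<open>The domain of \<open>F\<^sub>X\<close>. It need not be a product, since the admissible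
  size of \<epsilon> depends on \<eta>.\<close>

definition pert_domain :: "'a set \<Rightarrow> (('a::hausdorff_lcs ^ 'n::{finite,linorder}) \<times> real) set" where
  "pert_domain M = {z. u_hat (fst z) (snd z) \<in> M}"

lemma open_pert_domain:
  assumes "open M"
  shows "open (pert_domain M)"
proof -
  have "smooth_on UNIV (\<lambda>z::('a ^ 'n::{finite,linorder}) \<times> real. u_hat (fst z) (snd z))"
    by (intro smooth_on_u_hat smooth_on_fst smooth_on_snd smooth_on_ident open_UNIV)
  from open_vimage[OF assms smooth_on_imp_continuous_on[OF this]]
  show ?thesis by (simp add: pert_domain_def vimage_def)
qed

lemma smooth_on_pert_domain:
  assumes "open M" "smooth_on M X"
  shows "smooth_on (pert_domain M) (\<lambda>z. X (u_hat (fst z) (snd z)))"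
  by (intro smooth_on_compose[OF assms(2,1)] smooth_on_u_hat smooth_on_fst smooth_on_snd
      smooth_on_ident open_pert_domain assms) (auto simp: pert_domain_def)

lemma M_hat_iff: "\<eta> \<in> M_hat M \<longleftrightarrow> (\<eta>, 0) \<in> pert_domain M"
  by (simp add: M_hat_def pert_domain_def u_hat_0)

lemma open_curve_domain:
  fixes M :: "'a::hausdorff_lcs set"
  assumes "open M"
  shows "open {\<epsilon>. u_hat \<eta> \<epsilon> \<in> M}"
proof -
  have "smooth_on UNIV (u_hat \<eta>)"
    using smooth_on_u_hat[OF smooth_on_const smooth_on_ident, of UNIV \<eta>] by simp
  from open_vimage[OF assms smooth_on_imp_continuous_on[OF this]]
  show ?thesis by (simp add: vimage_def)
qed

lemma smooth_on_u_hat_curve: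
  fixes M :: "'a::hausdorff_lcs set"
  assumes "open M"
  shows "smooth_on {\<epsilon>. u_hat \<eta> \<epsilon> \<in> M} (u_hat \<xi>)"
  using open_curve_domain[OF assms]
  by (intro smooth_on_u_hat[where g = "\<lambda>_. \<xi>" and e = "\<lambda>\<epsilon>. \<epsilon>"] smooth_on_const smooth_on_ident)

lemma iter_gateaux_slice:
  "iter_gateaux G (replicate k (0, 1)) (\<eta>, t) = iter_gateaux (\<lambda>\<epsilon>::real. G (\<eta>, \<epsilon>)) (replicate k 1) t"
  using fun_cong[OF funpow_curve_deriv_line[of k G "(\<eta>, 0)" "(0, 1)"], of t]
  by (simp add: funpow_curve_deriv)

lemma pert_field_nth:
  assumes "\<eta> \<in> M_hat M"
  shows "pert_field M X \<eta> $ i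
    = (1 / fact (idx i)) *\<^sub>R iter_gateaux (\<lambda>\<epsilon>. X (u_hat \<eta> \<epsilon>)) (replicate (idx i) 1) 0"
  using assms by (simp add: pert_field_def funpow_curve_deriv)

text \<open>Derivatives of the two-variable map replace those of a single curve, so that the
  dependence on \<eta> becomes accessible.\<close>

lemma pert_field_eq:
  assumes "\<eta> \<in> M_hat M"
  shows "pert_field M X \<eta> = (\<chi> i. (1 / fact (idx i)) *\<^sub>R
    iter_gateaux (\<lambda>z. X (u_hat (fst z) (snd z))) (replicate (idx i) (0, 1)) (\<eta>, 0))"
  by (simp add: vec_eq_iff pert_field_nth[OF assms] iter_gateaux_slice)

lemma pert_field_in_vector_fields:
  assumes M: "open M" and X: "X \<in> vector_fields M"
  shows "pert_field M X \<in> vector_fields (M_hat M :: ('a::hausdorff_lcs ^ 'n::{finite,linorder}) set)"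
proof -
  let ?MN = "M_hat M :: (('a, 'n) vec) set"
  have MN: "open ?MN" using M by (rule open_M_hat)
  let ?F = "\<lambda>z::('a, 'n) vec \<times> real. X (u_hat (fst z) (snd z))"
  note F = smooth_on_pert_domain[OF M vector_fieldsD(1)[OF X]] open_pert_domain[OF M]
  have e: "smooth_on ?MN (\<lambda>\<eta>. (\<eta>, 0 :: real))"
    by (rule smooth_on_Pair[OF smooth_on_ident[OF MN] smooth_on_const[OF MN] MN])
  have sub: "(\<lambda>\<eta>. (\<eta>, 0)) ` ?MN \<subseteq> pert_domain M"
    by (auto simp: M_hat_iff)
  have "smooth_on ?MN (\<lambda>\<eta>. iter_gateaux ?F vs (\<eta>, 0))" for vs
    by (rule smooth_on_compose[OF smooth_on_iter_gateaux[OF F] F(2) e MN sub])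
  then have "smooth_on ?MN (\<lambda>\<eta>. \<chi> i. (1 / fact (idx i)) *\<^sub>R
      iter_gateaux ?F (replicate (idx i) (0, 1)) (\<eta>, 0))"
    by (intro smooth_on_vec_lambda smooth_on_scaleR_const MN)
  then have "smooth_on ?MN (pert_field M X)"
    by (rule smooth_on_cong[OF MN]) (simp add: pert_field_eq)
  then show ?thesis by (simp add: vector_fields_def pert_field_def)
qed

lemma gateaux_pert_field_nth:
  fixes \<eta> \<xi> :: "'a::hausdorff_lcs ^ 'n::{finite,linorder}"
  assumes M: "open M" and X: "X \<in> vector_fields M" and \<eta>: "\<eta> \<in> M_hat M"
  shows "gateaux (pert_field M X) \<eta> \<xi> $ i = (1 / fact (idx i)) *\<^sub>R
    iter_gateaux (\<lambda>\<epsilon>. gateaux X (u_hat \<eta> \<epsilon>) (u_hat \<xi> \<epsilon>)) (replicate (idx i) 1) 0"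
proof -
  let ?F = "\<lambda>z. X (u_hat (fst z) (snd z))"
  let ?es = "\<lambda>i::'n. replicate (idx i) (0, 1::real)"
  note F = smooth_on_pert_domain[OF M vector_fieldsD(1)[OF X]] open_pert_domain[OF M]
  have z: "(\<eta>, 0) \<in> pert_domain M" using \<eta> by (simp add: M_hat_iff)
  \<comment> \<open>Varying \<eta> is differentiation of the two-variable map in direction
    \<open>(\<xi>, 0)\<close>, here outermost.\<close>
  have "has_gateaux (\<lambda>\<eta>. iter_gateaux ?F (?es i) (\<eta>, 0)) \<eta> \<xi> (iter_gateaux ?F ((\<xi>, 0) # ?es i) (\<eta>, 0))" for i
    using smooth_on_has_dd[OF F(1) z, of "?es i" "(\<xi>, 0)"] by (simp add: has_gateaux_def)
  then have "has_gateaux (\<lambda>\<eta>. \<chi> i. (1 / fact (idx i)) *\<^sub>R iter_gateaux ?F (?es i) (\<eta>, 0)) \<eta> \<xi>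
      (\<chi> i. (1 / fact (idx i)) *\<^sub>R iter_gateaux ?F ((\<xi>, 0) # ?es i) (\<eta>, 0))"
    by (intro has_gateaux_vec_lambda has_gateaux_scaleR)
  then have "gateaux (\<lambda>\<eta>. \<chi> i. (1 / fact (idx i)) *\<^sub>R iter_gateaux ?F (?es i) (\<eta>, 0)) \<eta> \<xi>
      = (\<chi> i. (1 / fact (idx i)) *\<^sub>R iter_gateaux ?F ((\<xi>, 0) # ?es i) (\<eta>, 0))"
    by (rule gateaux_eqI)
  moreover have "gateaux (pert_field M X) \<eta> \<xi>
      = gateaux (\<lambda>\<eta>. \<chi> i. (1 / fact (idx i)) *\<^sub>R iter_gateaux ?F (?es i) (\<eta>, 0)) \<eta> \<xi>"
    by (intro gateaux_cong[OF open_M_hat[OF M] \<eta>] pert_field_eq)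
  ultimately have "gateaux (pert_field M X) \<eta> \<xi> $ i
      = (1 / fact (idx i)) *\<^sub>R iter_gateaux ?F ((\<xi>, 0) # ?es i) (\<eta>, 0)"
    by simp
  \<comment> \<open>After the rotation the variation of \<eta> is taken first, and the remaining
    derivatives are those in \<epsilon> at fixed \<eta>.\<close>
  also have "iter_gateaux ?F ((\<xi>, 0) # ?es i) (\<eta>, 0)
      = iter_gateaux (\<lambda>z. gateaux ?F z (\<xi>, 0)) (?es i) (\<eta>, 0)"
    unfolding iter_gateaux_rotate[OF F z] iter_gateaux_snoc ..
  also have "\<dots> = iter_gateaux (\<lambda>\<epsilon>. gateaux ?F (\<eta>, \<epsilon>) (\<xi>, 0)) (replicate (idx i) 1) 0"
    by (rule iter_gateaux_slice)
  \<comment> \<open>As \<open>u_hat\<close> is linear in \<eta>, both sides are limits of the same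
    difference quotients.\<close>
  also have "(\<lambda>\<epsilon>. gateaux ?F (\<eta>, \<epsilon>) (\<xi>, 0)) = (\<lambda>\<epsilon>. gateaux X (u_hat \<eta> \<epsilon>) (u_hat \<xi> \<epsilon>))"
    by (simp add: gateaux_def u_hat_add_scaleR)
  finally show ?thesis .
qed

section \<open>Taylor polynomials and the homomorphism property\<close>

lemma iter_gateaux_u_hat:
  "iter_gateaux (u_hat \<xi>) (replicate (idx i) 1) 0 = fact (idx i) *\<^sub>R (\<xi> $ i)"
proof -
  have "u_hat \<xi> = (\<lambda>\<epsilon>. \<Sum>j\<in>UNIV. \<epsilon> ^ idx j *\<^sub>R (\<xi> $ j))"
    by (simp add: u_hat_def fun_eq_iff)
  moreover have "iter_gateaux (\<lambda>\<epsilon>. \<Sum>j\<in>UNIV. \<epsilon> ^ idx j *\<^sub>R (\<xi> $ j)) (replicate (idx i) 1) 0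
      = (\<Sum>j\<in>UNIV. iter_gateaux (\<lambda>\<epsilon>. \<epsilon> ^ idx j *\<^sub>R (\<xi> $ j)) (replicate (idx i) 1) 0)"
    by (intro iter_gateaux_sum[where U = UNIV] smooth_on_scaleR smooth_on_power smooth_on_ident
        smooth_on_const) simp_all
  moreover have "\<dots> = (\<Sum>j\<in>UNIV. if j = i then fact (idx i) *\<^sub>R (\<xi> $ j) else 0)"
    unfolding iter_gateaux_power_0
    by (intro sum.cong) (auto dest: injD[OF inj_idx])
  ultimately show ?thesis by simp
qed

text \<open>The factorial from differentiating a monomial cancels the \<open>1 / fact\<close> in
  \<open>pert_field\<close>. The bound on \<open>j\<close> ensures that some position carries the
  order \<open>j\<close>.\<close>

lemma iter_gateaux_u_hat_pert_field:
  fixes \<eta> :: "'a::hausdorff_lcs ^ 'n::{finite,linorder}"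
  assumes "\<eta> \<in> M_hat M" "j < CARD('n)"
  shows "iter_gateaux (u_hat (pert_field M S \<eta>)) (replicate j 1) 0
    = iter_gateaux (\<lambda>\<epsilon>. S (u_hat \<eta> \<epsilon>)) (replicate j 1) 0"
proof -
  obtain i :: 'n where "j = idx i"
    using assms(2) bij_betw_idx unfolding bij_betw_def by (metis imageE lessThan_iff)
  then show ?thesis
    by (simp add: iter_gateaux_u_hat pert_field_nth[OF assms(1)])
qed

lemma iter_gateaux_pert_direction:
  fixes \<eta> :: "'a::hausdorff_lcs ^ 'n::{finite,linorder}" and i :: 'n
  assumes M: "open M" and K: "K \<in> vector_fields M" and S: "S \<in> vector_fields M" and \<eta>: "\<eta> \<in> M_hat M"
  shows "iter_gateaux (\<lambda>\<epsilon>. gateaux K (u_hat \<eta> \<epsilon>) (u_hat (pert_field M S \<eta>) \<epsilon>)) (replicate (idx i) 1) 0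
    = iter_gateaux (\<lambda>\<epsilon>. gateaux K (u_hat \<eta> \<epsilon>) (S (u_hat \<eta> \<epsilon>))) (replicate (idx i) 1) 0"
proof -
  define J where "J = {\<epsilon>. u_hat \<eta> \<epsilon> \<in> M}"
  let ?x = "u_hat (pert_field M S \<eta>)" and ?s = "\<lambda>\<epsilon>. S (u_hat \<eta> \<epsilon>)"
  let ?G = "\<lambda>z. gateaux K (u_hat \<eta> (fst z)) (snd z)"
  have J: "open J" "0 \<in> J"
    using \<eta> open_curve_domain[OF M] by (auto simp: J_def u_hat_0 M_hat_def)
  have V: "open (J \<times> (UNIV :: 'a set))" using J by (simp add: open_Times)
  have x: "smooth_on J ?x" unfolding J_def by (rule smooth_on_u_hat_curve[OF M])
  have s: "smooth_on J ?s"
    using smooth_on_u_hat_curve[OF M, of \<eta> \<eta>] J(1) unfolding J_def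
    by (intro smooth_on_compose[OF vector_fieldsD(1)[OF S] M]) auto
  note cK = smooth_on_c1_on_self[OF vector_fieldsD(1)[OF K]]
  have G: "smooth_on (J \<times> UNIV) ?G"
    by (intro smooth_on_gateaux_compose[OF vector_fieldsD(1)[OF K] M] smooth_on_u_hat smooth_on_fst
        smooth_on_snd smooth_on_ident smooth_on_const V) (auto simp: J_def)
  have lin: "linear (\<lambda>y. ?G (\<epsilon>, y))" if "\<epsilon> \<in> J" for \<epsilon>
    using that unfolding J_def
    by (intro linearI) (simp_all add: gateaux_add[OF cK M] gateaux_scaleR[OF cK M])
  have comp: "smooth_on J (\<lambda>\<epsilon>. ?G (\<epsilon>, b \<epsilon>))" if "smooth_on J b" for b
    using that by (intro smooth_on_compose[OF G V] smooth_on_Pair smooth_on_ident J) auto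
  \<comment> \<open>The two curves agree to order \<open>CARD('n) - 1\<close>, so the lemma on
    vanishing jets applies to their difference, written with scalar factors to fit
    \<open>iter_gateaux_lincomb\<close>.\<close>
  have "iter_gateaux (\<lambda>\<epsilon>. ?G (\<epsilon>, 1 *\<^sub>R ?x \<epsilon> + (-1) *\<^sub>R ?s \<epsilon>)) (replicate (idx i) 1) 0 = 0"
  proof (rule iter_gateaux_vanishing_jet[OF J G lin])
    show "smooth_on J (\<lambda>\<epsilon>. 1 *\<^sub>R ?x \<epsilon> + (-1) *\<^sub>R ?s \<epsilon>)"
      by (intro smooth_on_add smooth_on_scaleR_const x s J)
    fix j assume "j \<le> idx i"
    also have "idx i < CARD('n)" using bij_betw_apply[OF bij_betw_idx, of i] by simp
    finally have "j < CARD('n)" .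
    then show "iter_gateaux (\<lambda>\<epsilon>. 1 *\<^sub>R ?x \<epsilon> + (-1) *\<^sub>R ?s \<epsilon>) (replicate j 1) 0 = 0"
      unfolding iter_gateaux_lincomb[OF x s J] by (simp add: iter_gateaux_u_hat_pert_field[OF \<eta>])
  qed
  also have "iter_gateaux (\<lambda>\<epsilon>. ?G (\<epsilon>, 1 *\<^sub>R ?x \<epsilon> + (-1) *\<^sub>R ?s \<epsilon>)) (replicate (idx i) 1) 0
      = iter_gateaux (\<lambda>\<epsilon>. 1 *\<^sub>R ?G (\<epsilon>, ?x \<epsilon>) + (-1) *\<^sub>R ?G (\<epsilon>, ?s \<epsilon>)) (replicate (idx i) 1) 0"
    by (intro iter_gateaux_cong[OF J])
      (simp only: linear_add[OF lin] linear_scale[OF lin])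
  also have "\<dots> = 1 *\<^sub>R iter_gateaux (\<lambda>\<epsilon>. ?G (\<epsilon>, ?x \<epsilon>)) (replicate (idx i) 1) 0
      + (-1) *\<^sub>R iter_gateaux (\<lambda>\<epsilon>. ?G (\<epsilon>, ?s \<epsilon>)) (replicate (idx i) 1) 0"
    by (rule iter_gateaux_lincomb[OF comp[OF x] comp[OF s] J])
  finally show ?thesis by simp
qed

lemma commutator_pert_field:
  fixes M :: "'a::hausdorff_lcs set"
  assumes M: "open M" and K: "K \<in> vector_fields M" and S: "S \<in> vector_fields M"
  shows "commutator (M_hat M) (pert_field M K) (pert_field M S)
    = (pert_field M (commutator M K S) :: 'a ^ 'n::{finite,linorder} \<Rightarrow> ('a, 'n) vec)"
proof
  fix \<eta> :: "('a, 'n) vec"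
  show "commutator (M_hat M) (pert_field M K) (pert_field M S) \<eta> = pert_field M (commutator M K S) \<eta>"
  proof (cases "\<eta> \<in> M_hat M")
    case \<eta>: True
    define J where "J = {\<epsilon>. u_hat \<eta> \<epsilon> \<in> M}"
    have J: "open J" "0 \<in> J"
      using \<eta> open_curve_domain[OF M] by (auto simp: J_def u_hat_0 M_hat_def)
    have sm: "smooth_on J (\<lambda>\<epsilon>. gateaux X (u_hat \<eta> \<epsilon>) (Y (u_hat \<eta> \<epsilon>)))"
      if "X \<in> vector_fields M" "Y \<in> vector_fields M" for X Y
      using J(1) smooth_on_u_hat_curve[OF M, of \<eta> \<eta>] unfolding J_def
      by (intro smooth_on_gateaux_compose[OF vector_fieldsD(1)[OF that(1)] M]
          smooth_on_compose[OF vector_fieldsD(1)[OF that(2)] M]) auto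
    have "commutator (M_hat M) (pert_field M K) (pert_field M S) \<eta> $ i
        = pert_field M (commutator M K S) \<eta> $ i" for i
    proof -
      let ?es = "replicate (idx i) (1::real)"
      let ?KS = "\<lambda>\<epsilon>. gateaux K (u_hat \<eta> \<epsilon>) (S (u_hat \<eta> \<epsilon>))"
      let ?SK = "\<lambda>\<epsilon>. gateaux S (u_hat \<eta> \<epsilon>) (K (u_hat \<eta> \<epsilon>))"
      have "commutator (M_hat M) (pert_field M K) (pert_field M S) \<eta> $ i
          = (1 / fact (idx i)) *\<^sub>R (1 *\<^sub>R iter_gateaux ?KS ?es 0 + (-1) *\<^sub>R iter_gateaux ?SK ?es 0)"
        using \<eta> by (simp add: commutator_def gateaux_pert_field_nth[OF M] K S
            iter_gateaux_pert_direction[OF M] scaleR_diff_right)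
      also have "1 *\<^sub>R iter_gateaux ?KS ?es 0 + (-1) *\<^sub>R iter_gateaux ?SK ?es 0
          = iter_gateaux (\<lambda>\<epsilon>. 1 *\<^sub>R ?KS \<epsilon> + (-1) *\<^sub>R ?SK \<epsilon>) ?es 0"
        by (rule iter_gateaux_lincomb[OF sm[OF K S] sm[OF S K] J, symmetric])
      also have "\<dots> = iter_gateaux (\<lambda>\<epsilon>. commutator M K S (u_hat \<eta> \<epsilon>)) ?es 0"
        by (intro iter_gateaux_cong[OF J]) (simp add: J_def commutator_def)
      finally show ?thesis by (simp add: pert_field_nth[OF \<eta>])
    qed
    then show ?thesis by (simp add: vec_eq_iff)
  \<comment> \<open>Outside \<open>M_hat M\<close> both sides take the normalized value
    \<open>0\<close>.\<close>
  qed (simp add: commutator_def pert_field_def)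
qed

section \<open>Linearity, injectivity and the assertions on symmetries\<close>

lemma pert_field_lincomb:
  assumes M: "open M" and X: "X \<in> vector_fields M" and Y: "Y \<in> vector_fields M"
  shows "pert_field M (\<lambda>u. a *\<^sub>R X u + b *\<^sub>R Y u)
    = (\<lambda>\<eta>. a *\<^sub>R pert_field M X \<eta> + b *\<^sub>R pert_field M Y \<eta>)"
proof
  fix \<eta> :: "('a, 'b) vec"
  show "pert_field M (\<lambda>u. a *\<^sub>R X u + b *\<^sub>R Y u) \<eta> = a *\<^sub>R pert_field M X \<eta> + b *\<^sub>R pert_field M Y \<eta>"
  proof (cases "\<eta> \<in> M_hat M")
    case \<eta>: True
    define J where "J = {\<epsilon>. u_hat \<eta> \<epsilon> \<in> M}"
    have J: "open J" "0 \<in> J"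
      using \<eta> open_curve_domain[OF M] by (auto simp: J_def u_hat_0 M_hat_def)
    have sm: "smooth_on J (\<lambda>\<epsilon>. Z (u_hat \<eta> \<epsilon>))" if "Z \<in> vector_fields M" for Z
      using J(1) smooth_on_u_hat_curve[OF M, of \<eta> \<eta>] unfolding J_def
      by (intro smooth_on_compose[OF vector_fieldsD(1)[OF that] M]) auto
    show ?thesis
      by (simp add: vec_eq_iff pert_field_nth[OF \<eta>] iter_gateaux_lincomb[OF sm[OF X] sm[OF Y] J]
          scaleR_add_right mult.commute)
  qed (simp add: pert_field_def)
qed

lemma pert_field_zero: "pert_field M (\<lambda>_. 0) = (\<lambda>_. 0)"
  by (auto simp: pert_field_def vec_eq_iff fun_eq_iff funpow_curve_deriv iter_gateaux_const)

text \<open>The component of order \<open>0\<close> at \<eta> is the value of the field at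
  \<open>\<eta>\<^sub>0\<close>, and the constant block vector realizes any \<open>u\<close> in
  \<open>M\<close> as \<open>\<eta>\<^sub>0\<close>; outside \<open>M\<close> the normalization to
  \<open>0\<close> decides.\<close>

lemma inj_on_pert_field:
  "inj_on (pert_field M :: _ \<Rightarrow> 'a::hausdorff_lcs ^ 'n::{finite,linorder} \<Rightarrow> ('a, 'n) vec) (vector_fields M)"
proof (rule inj_onI, rule ext)
  fix X Y u
  assume vf: "X \<in> vector_fields M" "Y \<in> vector_fields M"
    and eq: "(pert_field M X :: ('a, 'n) vec \<Rightarrow> ('a, 'n) vec) = pert_field M Y"
  show "X u = Y u"
  proof (cases "u \<in> M")
    case True
    define \<eta> :: "('a, 'n) vec" where "\<eta> = (\<chi> i. u)"
    have \<eta>: "\<eta> \<in> M_hat M" using True by (simp add: \<eta>_def M_hat_def)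
    have "pert_field M Z \<eta> $ Min UNIV = Z u" for Z
      by (simp add: pert_field_nth[OF \<eta>] idx_Min u_hat_0) (simp add: \<eta>_def)
    then show ?thesis using eq by metis
  qed (simp add: vector_fieldsD(2)[OF vf(1)] vector_fieldsD(2)[OF vf(2)])
qed

text \<open>Membership is carried along because the homomorphism property is applied to each iterate
  in turn.\<close>

lemma funpow_commutator_pert_field:
  assumes "open M" "K \<in> vector_fields M" "\<sigma> \<in> vector_fields M"
  shows "(commutator M K ^^ k) \<sigma> \<in> vector_fields M \<and>
    (commutator (M_hat M) (pert_field M K) ^^ k) (pert_field M \<sigma>) = pert_field M ((commutator M K ^^ k) \<sigma>)"
  by (induction k) (simp_all add: assms commutator_in_vector_fields commutator_pert_field)

text \<open>The isomorphism in (2) is onto the image and not onto all symmetries of the perturbation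
  equation: for nonzero \<open>K\<close> and \<open>N \<ge> 1\<close> the field
  \<open>(0, \<dots>, 0, K(\<eta>\<^sub>0))\<close> is a symmetry, but it is not a perturbation
  field, as its component of order \<open>0\<close> vanishes.\<close>

theorem theorem3p2:
  fixes M :: "'a::hausdorff_lcs set" and N :: nat and K S :: "'a \<Rightarrow> 'a"
    and MN :: "('a ^ 'n::{finite,linorder}) set"
    and hat :: "('a \<Rightarrow> 'a) \<Rightarrow> ('a ^ 'n::{finite,linorder} \<Rightarrow> 'a ^ 'n::{finite,linorder})"
  assumes "N \<ge> 1" and "CARD('n) = N + 1"
    and "open M" and "K \<in> vector_fields M" and "S \<in> vector_fields M"
  defines "MN \<equiv> M_hat M" and "hat \<equiv> pert_field M"
  shows "open MN \<and> (\<forall>X\<in>vector_fields M. hat X \<in> vector_fields MN)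
    \<and> commutator M K S \<in> vector_fields M
    \<and> commutator MN (hat K) (hat S) = hat (commutator M K S)
    \<and> (\<forall>n \<sigma>. master_symmetry n M K \<sigma> \<longrightarrow> master_symmetry n MN (hat K) (hat \<sigma>))
    \<and> hat ` symmetry_algebra M K \<subseteq> symmetry_algebra MN (hat K)
    \<and> vf_subalgebra MN (symmetry_algebra MN (hat K))
    \<and> vf_algebra_iso M (symmetry_algebra M K) MN (hat ` symmetry_algebra M K) hat"
proof -
  note M = assms(3) and K = assms(4)
  have MN: "open MN" unfolding MN_def using M by (rule open_M_hat)
  have hat: "hat X \<in> vector_fields MN" if "X \<in> vector_fields M" for X
    unfolding MN_def hat_def using M that by (rule pert_field_in_vector_fields)
  have com: "commutator MN (hat X) (hat Y) = hat (commutator M X Y)"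
    if "X \<in> vector_fields M" "Y \<in> vector_fields M" for X Y
    unfolding MN_def hat_def using M that by (rule commutator_pert_field)
  have lc: "hat (\<lambda>u. a *\<^sub>R X u + b *\<^sub>R Y u) = (\<lambda>\<eta>. a *\<^sub>R hat X \<eta> + b *\<^sub>R hat Y \<eta>)"
    if "X \<in> vector_fields M" "Y \<in> vector_fields M" for X Y a b
    unfolding hat_def using M that by (rule pert_field_lincomb)
  have zero: "hat (\<lambda>_. 0) = (\<lambda>_. 0)" unfolding hat_def by (rule pert_field_zero)
  define A where "A = symmetry_algebra M K"
  have AV: "A \<subseteq> vector_fields M" by (auto simp: A_def symmetry_algebra_def)
  have A: "vf_subalgebra M A" unfolding A_def using M K by (rule vf_subalgebra_symmetry_algebra)
  have "master_symmetry n MN (hat K) (hat \<sigma>)" if "master_symmetry n M K \<sigma>" for n \<sigma>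
    using that funpow_commutator_pert_field[OF M K, of \<sigma> "n + 1"] hat zero
    unfolding master_symmetry_def MN_def hat_def by metis
  moreover have sub: "hat ` A \<subseteq> symmetry_algebra MN (hat K)"
    using hat com[OF K] zero by (auto simp: A_def symmetry_algebra_def)
  moreover have "vf_subalgebra MN (symmetry_algebra MN (hat K))"
    using MN hat[OF K] by (rule vf_subalgebra_symmetry_algebra)
  moreover have "vf_algebra_iso M A MN (hat ` A) hat"
    unfolding vf_algebra_iso_def
  proof (intro conjI ballI allI A)
    show "bij_betw hat A (hat ` A)"
      using inj_on_subset[OF inj_on_pert_field AV] unfolding hat_def by (rule inj_on_imp_bij_betw)
    show "hat (\<lambda>u. a *\<^sub>R X u + b *\<^sub>R Y u) = (\<lambda>\<eta>. a *\<^sub>R hat X \<eta> + b *\<^sub>R hat Y \<eta>)"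
      if "X \<in> A" "Y \<in> A" for X Y a b
      using that AV by (intro lc) auto
    show "hat (commutator M X Y) = commutator MN (hat X) (hat Y)" if "X \<in> A" "Y \<in> A" for X Y
      using that AV by (intro com[symmetric]) auto
    show "vf_subalgebra MN (hat ` A)"
      unfolding vf_subalgebra_def
    proof (intro conjI ballI allI)
      show "hat ` A \<subseteq> vector_fields MN" using hat AV by auto
      show "(\<lambda>_. 0) \<in> hat ` A"
        using A zero unfolding vf_subalgebra_def by (metis image_eqI)
      fix X' Y' assume "X' \<in> hat ` A" "Y' \<in> hat ` A"
      then obtain X Y where X: "X \<in> A" "X' = hat X" and Y: "Y \<in> A" "Y' = hat Y" by blast
      have XY: "X \<in> vector_fields M" "Y \<in> vector_fields M" using X Y AV by auto
      have "(\<lambda>u. a *\<^sub>R X u + b *\<^sub>R Y u) \<in> A" for a b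
        using A X(1) Y(1) unfolding vf_subalgebra_def by blast
      then show "(\<lambda>\<eta>. a *\<^sub>R X' \<eta> + b *\<^sub>R Y' \<eta>) \<in> hat ` A" for a b
        unfolding X(2) Y(2) lc[OF XY, symmetric] by (rule imageI)
      have "commutator M X Y \<in> A"
        using A X(1) Y(1) unfolding vf_subalgebra_def by blast
      then show "commutator MN X' Y' \<in> hat ` A"
        unfolding X(2) Y(2) com[OF XY] by (rule imageI)
    qed
  qed
  ultimately show ?thesis
    using MN hat com[OF K assms(5)] commutator_in_vector_fields[OF M K assms(5)]
    unfolding A_def by blast
qed

end
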